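(* Let $(A,\mathfrak m)$ be a Noetherian local ring with infinite residue field and let $I$ be a regular ideal of $A$ with analytic spread one and reduction number $r$. For a minimal reduction $J=(a)$ of $I$, write the graded decomposition of $F(I)$ as an $F(J)$-module as $$F(I)\cong\bigoplus_{i=0}^r(F(J)(-i))^{\alpha_i}\oplus\bigoplus_{i=1}^{r-1}\bigoplus_{j=1}^{r-i}\left((F(J)/a^{j}F(J))(-i)\right)^{\alpha_{i,j}}.$$ Then the invariants $\alpha_i$, for $0\leq i\leq r$, are independent of the choice of the minimal reduction $J$.
   Context: For an ideal $L$ of $A$, $F(L)=\bigoplus_{n\ge0}L^n/\mathfrak m L^n$ (with $L^0=A$) is its fiber cone; the analytic spread of $I$ is $l(I)=\dim F(I)$. An ideal is regular if it contains a non-zero-divisor of $A$. A reduction of $I$ is an ideal $J\subseteq I$ with $I^{n+1}=JI^n$ for some $n$; it is minimal if it is minimal under inclusion among reductions. When $l(I)=1$ (and the residue field is infinite) the minimal reductions of $I$ are principal; for $I$ regular of analytic spread one, the least $r$ with $I^{r+1}=JI^r$ does not depend on the minimal reduction $J$ and is called the reduction number $r$ of $I$. For a minimal reduction $J=(a)$, $F(J)\subseteq F(I)$ is a polynomial ring over $A/\mathfrak m$ in the one variable $a^0$ = class of $a$ in $I/\mathfrak m I$, and $F(I)$ is a finitely generated graded $F(J)$-module; $a^jF(J)$ means $(a^0)^jF(J)$, and $M(-i)_n=M_{n-i}$. A decomposition of the displayed form always exists, with exponents uniquely determined by $J$. *)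

theory Defs
  imports "HOL-Algebra.Algebra" "HOL-Library.Extended_Nat"
begin

section \<open>Local rings, Krull dimension, regular ideals\<close>

locale noetherian_local_ring = cring R + noetherian_ring R for R (structure) +
  fixes \<mm> :: "'a set"
  assumes max_ideal: "maximalideal \<mm> R"
    and max_ideal_unique: "maximalideal M R \<Longrightarrow> M = \<mm>"

text \<open>Supremum of the lengths of strict chains of prime ideals; the zero ring, which has no
  primes, gets the value \<open>0\<close>.\<close>

definition krull_dim :: "('a, 'b) ring_scheme \<Rightarrow> enat" where
  "krull_dim R = Sup {enat n | n. \<exists>P :: nat \<Rightarrow> 'a set.
     (\<forall>i\<le>n. primeideal (P i) R) \<and> (\<forall>i<n. P i \<subset> P (Suc i))}"

definition regular_ideal :: "('a, 'b) ring_scheme \<Rightarrow> 'a set \<Rightarrow> bool" where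
  "regular_ideal R L \<longleftrightarrow> ideal L R \<and>
     (\<exists>x\<in>L. \<forall>y\<in>carrier R. x \<otimes>\<^bsub>R\<^esub> y = \<zero>\<^bsub>R\<^esub> \<longrightarrow> y = \<zero>\<^bsub>R\<^esub>)"

text \<open>Ideal powers are powers in the semiring of ideals, whose unit is \<open>carrier R\<close>; so the
  zeroth power of an ideal is the whole ring.\<close>

abbreviation ideal_pow :: "('a, 'b) ring_scheme \<Rightarrow> 'a set \<Rightarrow> nat \<Rightarrow> 'a set" where
  "ideal_pow R L n \<equiv> L [^]\<^bsub>ideals_set R\<^esub> n"

section \<open>Reductions\<close>

definition is_reduction :: "('a, 'b) ring_scheme \<Rightarrow> 'a set \<Rightarrow> 'a set \<Rightarrow> bool" where
  "is_reduction R L J \<longleftrightarrow> ideal J R \<and> J \<subseteq> L \<and>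
     (\<exists>n. ideal_pow R L (Suc n) = ideal_prod R J (ideal_pow R L n))"

definition minimal_reduction :: "('a, 'b) ring_scheme \<Rightarrow> 'a set \<Rightarrow> 'a set \<Rightarrow> bool" where
  "minimal_reduction R L J \<longleftrightarrow> is_reduction R L J \<and>
     (\<forall>K. is_reduction R L K \<and> K \<subseteq> J \<longrightarrow> K = J)"

text \<open>The least \<open>n\<close> with \<open>L\<^sup>n\<^sup>+\<^sup>1 = J L\<^sup>n\<close> for some minimal reduction \<open>J\<close>. For a regular ideal of
  analytic spread one over a Noetherian local ring with infinite residue field,
  the least such \<open>n\<close> is the same for every \<open>J\<close>.\<close>

definition reduction_number :: "('a, 'b) ring_scheme \<Rightarrow> 'a set \<Rightarrow> nat" where
  "reduction_number R L = (LEAST n. \<exists>J. minimal_reduction R L J \<and>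
     ideal_pow R L (Suc n) = ideal_prod R J (ideal_pow R L n))"

section \<open>The fiber cone\<close>

definition fiber_den :: "('a, 'b) ring_scheme \<Rightarrow> 'a set \<Rightarrow> 'a set \<Rightarrow> nat \<Rightarrow> 'a set" where
  "fiber_den R \<mm> L n = ideal_prod R \<mm> (ideal_pow R L n)"

text \<open>The degree \<open>n\<close> component \<open>L\<^sup>n / \<mm>L\<^sup>n\<close> consists of cosets and is a subgroup of the
  additive group of the ring \<open>R Quot \<mm>L\<^sup>n\<close>. An element of the fiber cone is the finitely supported
  sequence of its components, and the multiplication is induced by
  \<open>L\<^sup>i \<times> L\<^sup>n\<^sup>-\<^sup>i \<rightarrow> L\<^sup>n\<close>; \<open>rcoset_mult R (fiber_den R \<mm> L n)\<close> sends the classes of \<open>x\<close> and \<open>y\<close>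
  to the class of \<open>x \<otimes> y\<close> modulo \<open>\<mm>L\<^sup>n\<close>.\<close>

definition fiber_cone ::
    "('a, 'b) ring_scheme \<Rightarrow> 'a set \<Rightarrow> 'a set \<Rightarrow> (nat \<Rightarrow> 'a set) ring" where
  "fiber_cone R \<mm> L =
    \<lparr> carrier = {f. (\<forall>n. f n \<in> (\<lambda>x. fiber_den R \<mm> L n +>\<^bsub>R\<^esub> x) ` ideal_pow R L n) \<and>
                    finite {n. f n \<noteq> fiber_den R \<mm> L n}},
      monoid.mult = (\<lambda>f g n. \<Oplus>\<^bsub>R Quot fiber_den R \<mm> L n\<^esub> i\<in>{..n}.
                        rcoset_mult R (fiber_den R \<mm> L n) (f i) (g (n - i))),
      one = (\<lambda>n. if n = 0 then fiber_den R \<mm> L 0 +>\<^bsub>R\<^esub> \<one>\<^bsub>R\<^esub> else fiber_den R \<mm> L n),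
      ring.zero = fiber_den R \<mm> L,
      ring.add = (\<lambda>f g n. f n <+>\<^bsub>R\<^esub> g n) \<rparr>"

definition analytic_spread :: "('a, 'b) ring_scheme \<Rightarrow> 'a set \<Rightarrow> 'a set \<Rightarrow> enat" where
  "analytic_spread R \<mm> L = krull_dim (fiber_cone R \<mm> L)"

text \<open>The class of an element \<open>a \<in> L\<close> in degree one.\<close>

definition fiber_class ::
    "('a, 'b) ring_scheme \<Rightarrow> 'a set \<Rightarrow> 'a set \<Rightarrow> 'a \<Rightarrow> nat \<Rightarrow> 'a set" where
  "fiber_class R \<mm> L a =
     (\<lambda>n. if n = 1 then fiber_den R \<mm> L 1 +>\<^bsub>R\<^esub> a else fiber_den R \<mm> L n)"

text \<open>For \<open>J \<subseteq> L\<close>, the ring homomorphism \<open>F(J) \<rightarrow> F(L)\<close> induced by \<open>J\<^sup>n \<subseteq> L\<^sup>n\<close>: it sends a coset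
  \<open>\<mm>J\<^sup>n + x\<close> to \<open>\<mm>L\<^sup>n + (\<mm>J\<^sup>n + x) = \<mm>L\<^sup>n + x\<close>, so \<open>J\<close> does not occur in the formula.\<close>

definition fiber_map ::
    "('a, 'b) ring_scheme \<Rightarrow> 'a set \<Rightarrow> 'a set \<Rightarrow> (nat \<Rightarrow> 'a set) \<Rightarrow> nat \<Rightarrow> 'a set" where
  "fiber_map R \<mm> L f = (\<lambda>n. fiber_den R \<mm> L n <+>\<^bsub>R\<^esub> f n)"

section \<open>Graded modules\<close>

text \<open>A graded module is a module together with its homogeneous components. As for
  all modules of the library, the fields \<^const>\<open>monoid.mult\<close> and \<^const>\<open>one\<close> carry no meaning.\<close>

record ('s, 'x) graded_module = "('s, 'x) module" +
  homog :: "nat \<Rightarrow> 'x set"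

text \<open>The module \<open>M(-i)\<close> with \<open>M(-i)\<^sub>n = M\<^sub>n\<^sub>-\<^sub>i\<close>, where \<open>M\<^sub>k = 0\<close> for \<open>k < 0\<close>.\<close>

definition gm_shift :: "nat \<Rightarrow> ('s, 'x) graded_module \<Rightarrow> ('s, 'x) graded_module" where
  "gm_shift i M = M \<lparr> homog := (\<lambda>n. if n < i then {\<zero>\<^bsub>M\<^esub>} else homog M (n - i)) \<rparr>"

definition gm_quot :: "('s, 'x) graded_module \<Rightarrow> 'x set \<Rightarrow> ('s, 'x set) graded_module" where
  "gm_quot M N =
    \<lparr> carrier = a_rcosets\<^bsub>M\<^esub> N,
      monoid.mult = undefined,
      one = undefined,
      ring.zero = N,
      ring.add = set_add M,
      smult = (\<lambda>s C. \<Union>x\<in>C. N +>\<^bsub>M\<^esub> (s \<odot>\<^bsub>M\<^esub> x)),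
      homog = (\<lambda>n. (\<lambda>x. N +>\<^bsub>M\<^esub> x) ` homog M n) \<rparr>"

definition gm_dsum ::
    "'k set \<Rightarrow> ('k \<Rightarrow> ('s, 'x) graded_module) \<Rightarrow> ('s, 'k \<Rightarrow> 'x) graded_module" where
  "gm_dsum K M =
    (let C = {f \<in> (\<Pi>\<^sub>E k\<in>K. carrier (M k)). finite {k\<in>K. f k \<noteq> \<zero>\<^bsub>M k\<^esub>}} in
    \<lparr> carrier = C,
      monoid.mult = undefined,
      one = undefined,
      ring.zero = (\<lambda>k\<in>K. \<zero>\<^bsub>M k\<^esub>),
      ring.add = (\<lambda>f g. \<lambda>k\<in>K. f k \<oplus>\<^bsub>M k\<^esub> g k),
      smult = (\<lambda>s f. \<lambda>k\<in>K. s \<odot>\<^bsub>M k\<^esub> f k),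
      homog = (\<lambda>n. {f \<in> C. \<forall>k\<in>K. f k \<in> homog (M k) n}) \<rparr>)"

definition gm_power :: "('s, 'x) graded_module \<Rightarrow> nat \<Rightarrow> ('s, nat \<Rightarrow> 'x) graded_module" where
  "gm_power M c = gm_dsum {..<c} (\<lambda>_. M)"

definition gm_plus ::
    "('s, 'x) graded_module \<Rightarrow> ('s, 'y) graded_module \<Rightarrow> ('s, 'x \<times> 'y) graded_module" where
  "gm_plus M N =
    \<lparr> carrier = carrier M \<times> carrier N,
      monoid.mult = undefined,
      one = undefined,
      ring.zero = (\<zero>\<^bsub>M\<^esub>, \<zero>\<^bsub>N\<^esub>),
      ring.add = (\<lambda>(x, y) (x', y'). (x \<oplus>\<^bsub>M\<^esub> x', y \<oplus>\<^bsub>N\<^esub> y')),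
      smult = (\<lambda>s (x, y). (s \<odot>\<^bsub>M\<^esub> x, s \<odot>\<^bsub>N\<^esub> y)),
      homog = (\<lambda>n. homog M n \<times> homog N n) \<rparr>"

definition gm_isomorphic ::
    "('s, 'b) ring_scheme \<Rightarrow> ('s, 'x) graded_module \<Rightarrow> ('s, 'y) graded_module \<Rightarrow> bool" where
  "gm_isomorphic S M N \<longleftrightarrow> (\<exists>h. bij_betw h (carrier M) (carrier N) \<and>
     (\<forall>x\<in>carrier M. \<forall>y\<in>carrier M. h (x \<oplus>\<^bsub>M\<^esub> y) = h x \<oplus>\<^bsub>N\<^esub> h y) \<and>
     (\<forall>s\<in>carrier S. \<forall>x\<in>carrier M. h (s \<odot>\<^bsub>M\<^esub> x) = s \<odot>\<^bsub>N\<^esub> h x) \<and>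
     (\<forall>n. h ` homog M n = homog N n))"

section \<open>The fiber cone as a graded module\<close>

text \<open>\<open>F(L)\<close> as a graded module over \<open>F(J)\<close>, for ideals \<open>J \<subseteq> L\<close>, by restriction of scalars along
  \<open>F(J) \<rightarrow> F(L)\<close>. The definition makes sense for \<open>J = L\<close>, when \<^const>\<open>fiber_map\<close> is
  the identity and one gets \<open>F(L)\<close> as a module over itself.\<close>

definition fiber_module ::
    "('a, 'b) ring_scheme \<Rightarrow> 'a set \<Rightarrow> 'a set \<Rightarrow>
     (nat \<Rightarrow> 'a set, nat \<Rightarrow> 'a set) graded_module" where
  "fiber_module R \<mm> L = (let F = fiber_cone R \<mm> L in
    \<lparr> carrier = carrier F,
      monoid.mult = monoid.mult F,
      one = one F,
      ring.zero = ring.zero F,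
      ring.add = ring.add F,
      smult = (\<lambda>s f. fiber_map R \<mm> L s \<otimes>\<^bsub>F\<^esub> f),
      homog = (\<lambda>n. {f \<in> carrier F. \<forall>k. k \<noteq> n \<longrightarrow> f k = fiber_den R \<mm> L k}) \<rparr>)"

text \<open>With \<open>J = (a)\<close>, the graded \<open>F(J)\<close>-module \<open>F(L)\<close> is isomorphic to
  \<open>\<Oplus>\<^sub>i\<^sub>\<le>\<^sub>r F(J)(-i)\<^bsup>\<alpha> i\<^esup> \<oplus> \<Oplus>\<^sub>1\<^sub>\<le>\<^sub>i\<^sub>\<le>\<^sub>r\<^sub>-\<^sub>1 \<Oplus>\<^sub>1\<^sub>\<le>\<^sub>j\<^sub>\<le>\<^sub>r\<^sub>-\<^sub>i (F(J)/a\<^sup>jF(J))(-i)\<^bsup>\<tau> i j\<^esup>\<close>.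
  For \<open>r = 0\<close> the index set \<open>{1..r - 1}\<close> is empty, as it should be.\<close>

definition fiber_decomposition ::
    "('a, 'b) ring_scheme \<Rightarrow> 'a set \<Rightarrow> 'a set \<Rightarrow> 'a \<Rightarrow> nat \<Rightarrow>
     (nat \<Rightarrow> nat) \<Rightarrow> (nat \<Rightarrow> nat \<Rightarrow> nat) \<Rightarrow> bool" where
  "fiber_decomposition R \<mm> L a r \<alpha> \<tau> \<longleftrightarrow>
    (let J = PIdl\<^bsub>R\<^esub> a;
         S = fiber_cone R \<mm> J;
         FJ = fiber_module R \<mm> J;
         a0 = fiber_class R \<mm> J a
     in gm_isomorphic S (fiber_module R \<mm> L)
          (gm_plus
            (gm_dsum {0..r} (\<lambda>i. gm_power (gm_shift i FJ) (\<alpha> i)))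
            (gm_dsum {1..r - 1} (\<lambda>i. gm_dsum {1..r - i} (\<lambda>j.
               gm_power (gm_shift i (gm_quot FJ (PIdl\<^bsub>S\<^esub> (a0 [^]\<^bsub>S\<^esub> j)))) (\<tau> i j))))))"

end

theory Submission
  imports Defs
begin

text \<open>The torsion of \<open>F(I)\<close> over \<open>F(J)\<close>, \<open>J = (a)\<close>, consists in degree \<open>n\<close> of the classes of the
  \<open>x \<in> I\<^sup>n\<close> with \<open>a\<^sup>k x \<in> \<mm>I\<^sup>n\<^sup>+\<^sup>k\<close> for some \<open>k\<close>. Since \<open>I\<^sup>s\<^sup>+\<^sup>k = a\<^sup>k I\<^sup>s\<close> for a suitable \<open>s\<close>,
  such an \<open>x\<close> is also killed by a power of any other element of \<open>I\<close>, so the torsion does not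
  depend on \<open>J\<close>. The element \<open>a\<close> is regular because \<open>I\<close> is; hence the free summands have no
  torsion and \<open>F(J)(-i)\<close> contributes dimension one in each degree \<open>n \<ge> i\<close>. So the torsion-free
  quotient of \<open>F(I)\<close> has dimension \<open>\<Sum>i\<le>n. \<alpha> i\<close> over \<open>A/\<mm>\<close> in each degree \<open>n \<le> r\<close>, and these
  partial sums determine \<open>\<alpha>\<close>.\<close>

text \<open>The obstacle is that the two decompositions are isomorphisms over different rings,
  \<open>F((a))\<close> and \<open>F((b))\<close>, so they cannot be compared as modules. What they
  share is each degree \<open>n\<close> as a space over \<open>A/\<mm>\<close>, together with the
  torsion once it is described without \<open>F(J)\<close>. Dimensions of \<open>F(I)\<close> itself
  would mix the two kinds of exponents, since a summand \<open>(F(J)/a^j F(J))(-i)\<close>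
  contributes in the degrees from \<open>i\<close> to \<open>i + j - 1\<close>; this is why the
  torsion is divided out. The dimension is counted on elements of \<open>A\<close>: a numerator
  \<open>I^n\<close>, a denominator consisting of all representatives of torsion classes, and
  functionals on \<open>I^n\<close> with values in \<open>A/\<mm>\<close>. No vector space or
  quotient module has to be formed, and comparing two such systems needs only the solvability of
  homogeneous linear systems with more unknowns than equations. In the same spirit, the fiber cone
  is never treated as an abstract ring. Its product is a convolution of products of cosets, and the
  argument uses only products in which one factor is homogeneous, where the convolution collapses to
  a single term.\<close>

section \<open>Dual bases modulo a prime ideal\<close>

text \<open>Gaussian elimination without division: the induction removes one equation and one
  unknown at a time. The absence of zero divisors keeps the back-substituted solution
  non-zero.\<close>

lemma (in domain) underdetermined_system:
  assumes "finite K" "finite L" "card K < card L"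
    and "\<And>j k. j \<in> L \<Longrightarrow> k \<in> K \<Longrightarrow> c j k \<in> carrier R"
  shows "\<exists>y. (\<forall>j\<in>L. y j \<in> carrier R) \<and> (\<exists>j\<in>L. y j \<noteq> \<zero>) \<and> (\<forall>k\<in>K. (\<Oplus>j\<in>L. y j \<otimes> c j k) = \<zero>)"
  using assms
proof (induction K arbitrary: L c rule: finite_induct)
  case empty
  then obtain j where "j \<in> L" by (metis card.empty equals0I less_irrefl)
  then show ?case by (intro exI[of _ "\<lambda>_. \<one>"]) auto
next
  case (insert q K)
  show ?case
  proof (cases "\<forall>j\<in>L. c j q = \<zero>")
    case True
    have "card K < card L" using insert by simp
    then obtain y where y: "\<forall>j\<in>L. y j \<in> carrier R" "\<exists>j\<in>L. y j \<noteq> \<zero>"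
      "\<forall>k\<in>K. (\<Oplus>j\<in>L. y j \<otimes> c j k) = \<zero>"
      using insert.IH[of L c] insert.prems by blast
    have "(\<Oplus>j\<in>L. y j \<otimes> c j q) = (\<Oplus>j\<in>L. \<zero>)"
      using True y by (intro finsum_cong') auto
    then show ?thesis using y by (intro exI[of _ y]) auto
  next
    case False
    then obtain p where p: "p \<in> L" "c p q \<noteq> \<zero>" by blast
    define M where "M = L - {p}"
    have M: "finite M" "p \<notin> M" "L = insert p M" "card K < card M" "M \<subseteq> L"
      using insert p by (auto simp: M_def)
    \<comment> \<open>These are the 2x2 minors with pivot \<open>c p q\<close>: equation
      \<open>q\<close> eliminates the unknown \<open>p\<close> without dividing by the
      pivot.\<close>
    define d where "d j k = c p q \<otimes> c j k \<ominus> c j q \<otimes> c p k" for j k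
    have cc: "\<And>j k. j \<in> L \<Longrightarrow> k \<in> insert q K \<Longrightarrow> c j k \<in> carrier R" using insert by auto
    have dc: "\<And>j k. j \<in> M \<Longrightarrow> k \<in> K \<Longrightarrow> d j k \<in> carrier R" using cc M p by (auto simp: d_def)
    obtain z where z: "\<forall>j\<in>M. z j \<in> carrier R" "\<exists>j\<in>M. z j \<noteq> \<zero>"
      "\<forall>k\<in>K. (\<Oplus>j\<in>M. z j \<otimes> d j k) = \<zero>"
      using insert.IH[of M d] M dc by blast
    define s where "s = (\<Oplus>j\<in>M. z j \<otimes> c j q)"
    have sc: "s \<in> carrier R" unfolding s_def using z cc M by (intro finsum_closed) auto
    \<comment> \<open>Back-substitution scaled by the pivot. With this choice the left-hand side of
      every old equation equals that of the reduced one, and equation \<open>q\<close> becomes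
      trivial because its minors vanish.\<close>
    define y where "y j = (if j = p then \<ominus> s else c p q \<otimes> z j)" for j
    have yc: "\<forall>j\<in>L. y j \<in> carrier R" using z cc M sc p by (auto simp: y_def)
    have nz: "\<exists>j\<in>L. y j \<noteq> \<zero>"
    proof -
      obtain j where "j \<in> M" "z j \<noteq> \<zero>" using z by blast
      then show ?thesis using M z p cc integral_iff[of "c p q" "z j"]
        by (intro bexI[of _ j]) (auto simp: y_def)
    qed
    have eq: "(\<Oplus>j\<in>L. y j \<otimes> c j k) = (\<Oplus>j\<in>M. z j \<otimes> d j k)" if k: "k \<in> insert q K" for k
    proof -
      have "(\<Oplus>j\<in>L. y j \<otimes> c j k) = y p \<otimes> c p k \<oplus> (\<Oplus>j\<in>M. y j \<otimes> c j k)"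
        unfolding M(3) using M yc cc k by (intro finsum_insert) auto
      also have "(\<Oplus>j\<in>M. y j \<otimes> c j k) = (\<Oplus>j\<in>M. z j \<otimes> d j k \<oplus> (z j \<otimes> c j q) \<otimes> c p k)"
      proof (intro finsum_cong')
        fix j assume j: "j \<in> M"
        have [simp]: "z j \<in> carrier R" "c j k \<in> carrier R" "c j q \<in> carrier R" "c p k \<in> carrier R" "c p q \<in> carrier R"
          using j z cc M k p by auto
        have "u \<otimes> w \<otimes> t = w \<otimes> (u \<otimes> t \<ominus> v \<otimes> x) \<oplus> (w \<otimes> v) \<otimes> x"
          if "u \<in> carrier R" "v \<in> carrier R" "w \<in> carrier R" "t \<in> carrier R" "x \<in> carrier R"
          for u v w t x using that by algebra
        then show "y j \<otimes> c j k = z j \<otimes> d j k \<oplus> (z j \<otimes> c j q) \<otimes> c p k"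
          using j M unfolding y_def d_def by auto
      qed (use z cc M k p in \<open>auto simp: d_def\<close>)
      also have "\<dots> = (\<Oplus>j\<in>M. z j \<otimes> d j k) \<oplus> (\<Oplus>j\<in>M. (z j \<otimes> c j q) \<otimes> c p k)"
        using z cc M k p by (intro finsum_addf) (auto simp: d_def)
      also have "(\<Oplus>j\<in>M. (z j \<otimes> c j q) \<otimes> c p k) = s \<otimes> c p k"
        unfolding s_def using z cc M k p by (subst finsum_ldistr) auto
      finally have e: "(\<Oplus>j\<in>L. y j \<otimes> c j k) =
        \<ominus> s \<otimes> c p k \<oplus> ((\<Oplus>j\<in>M. z j \<otimes> d j k) \<oplus> s \<otimes> c p k)" by (simp add: y_def)
      have "(\<Oplus>j\<in>M. z j \<otimes> d j k) \<in> carrier R"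
        using z cc M k p by (intro finsum_closed) (auto simp: d_def)
      moreover have "c p k \<in> carrier R" using cc k p by auto
      moreover have "\<ominus> s \<otimes> x \<oplus> (t \<oplus> s \<otimes> x) = t" if "x \<in> carrier R" "t \<in> carrier R" for x t
        using that sc by algebra
      ultimately show ?thesis using e by simp
    qed
    have "(\<Oplus>j\<in>M. z j \<otimes> d j q) = (\<Oplus>j\<in>M. \<zero>)"
    proof (intro finsum_cong')
      fix j assume "j \<in> M"
      then show "z j \<otimes> d j q = \<zero>" using z cc M p by (auto simp: d_def m_comm r_neg a_minus_def)
    qed auto
    then show ?thesis using yc nz eq z by (intro exI[of _ y]) auto
  qed
qed

text \<open>A basis \<open>e\<close> of \<open>V/W\<close> over \<open>R/P\<close>, indexed by \<open>K\<close>, with its dual basis \<open>\<phi>\<close>.\<close>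

definition dual_system where
  "dual_system R P V W K \<phi> e \<longleftrightarrow>
    (\<forall>k\<in>K. \<forall>x\<in>V. \<phi> k x \<in> carrier (R Quot P)) \<and>
    (\<forall>k\<in>K. \<forall>x\<in>V. \<forall>y\<in>V. \<phi> k (x \<oplus>\<^bsub>R\<^esub> y) = \<phi> k x \<oplus>\<^bsub>R Quot P\<^esub> \<phi> k y) \<and>
    (\<forall>k\<in>K. \<forall>c\<in>carrier R. \<forall>x\<in>V. \<phi> k (c \<otimes>\<^bsub>R\<^esub> x) = (P +>\<^bsub>R\<^esub> c) \<otimes>\<^bsub>R Quot P\<^esub> \<phi> k x) \<and>
    (\<forall>x\<in>V. x \<in> W \<longleftrightarrow> (\<forall>k\<in>K. \<phi> k x = \<zero>\<^bsub>R Quot P\<^esub>)) \<and>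
    (\<forall>k\<in>K. e k \<in> V) \<and>
    (\<forall>k\<in>K. \<forall>l\<in>K. \<phi> l (e k) = (if l = k then \<one>\<^bsub>R Quot P\<^esub> else \<zero>\<^bsub>R Quot P\<^esub>))"

text \<open>Additivity is available only for summands in \<open>V\<close>, so the induction has to
  carry the membership of the partial sum along; hence the joint conclusion.\<close>

lemma dual_system_finsum:
  assumes "primeideal P R" "ideal V R" "dual_system R P V W K \<phi> e" "k \<in> K"
    and "finite L" "\<And>j. j \<in> L \<Longrightarrow> Y j \<in> carrier R" "\<And>j. j \<in> L \<Longrightarrow> f j \<in> V"
  shows "\<phi> k (\<Oplus>\<^bsub>R\<^esub>j\<in>L. Y j \<otimes>\<^bsub>R\<^esub> f j) = (\<Oplus>\<^bsub>R Quot P\<^esub>j\<in>L. (P +>\<^bsub>R\<^esub> Y j) \<otimes>\<^bsub>R Quot P\<^esub> \<phi> k (f j))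
    \<and> (\<Oplus>\<^bsub>R\<^esub>j\<in>L. Y j \<otimes>\<^bsub>R\<^esub> f j) \<in> V"
proof -
  interpret primeideal P R by fact
  interpret V: ideal V R by fact
  interpret Q: "domain" "R Quot P" by (rule quotient_is_domain)
  interpret h: ring_hom_cring R "R Quot P" "(+>\<^bsub>R\<^esub>) P" by (rule rcos_ring_hom_cring)
  have D: "\<And>x. x \<in> V \<Longrightarrow> \<phi> k x \<in> carrier (R Quot P)"
    "\<And>x y. x \<in> V \<Longrightarrow> y \<in> V \<Longrightarrow> \<phi> k (x \<oplus>\<^bsub>R\<^esub> y) = \<phi> k x \<oplus>\<^bsub>R Quot P\<^esub> \<phi> k y"
    "\<And>c x. c \<in> carrier R \<Longrightarrow> x \<in> V \<Longrightarrow> \<phi> k (c \<otimes>\<^bsub>R\<^esub> x) = (P +>\<^bsub>R\<^esub> c) \<otimes>\<^bsub>R Quot P\<^esub> \<phi> k x"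
    using assms(3,4) unfolding dual_system_def by blast+
  show ?thesis
    using assms(5-)
  proof (induction L rule: finite_induct)
    case empty
    \<comment> \<open>Zero is written as a product, so that the rule for scalars alone gives the
      value.\<close>
    have "\<phi> k (\<zero>\<^bsub>R\<^esub> \<otimes>\<^bsub>R\<^esub> \<zero>\<^bsub>R\<^esub>) = \<zero>\<^bsub>R Quot P\<^esub>"
      by (subst D(3)) (auto simp: D(1))
    then show ?case by simp
  next
    case (insert i L)
    have 1: "(\<Oplus>\<^bsub>R\<^esub>j\<in>insert i L. Y j \<otimes>\<^bsub>R\<^esub> f j) = Y i \<otimes>\<^bsub>R\<^esub> f i \<oplus>\<^bsub>R\<^esub> (\<Oplus>\<^bsub>R\<^esub>j\<in>L. Y j \<otimes>\<^bsub>R\<^esub> f j)"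
      using insert by (intro finsum_insert) (auto simp: V.Icarr)
    have 2: "(\<Oplus>\<^bsub>R Quot P\<^esub>j\<in>insert i L. (P +>\<^bsub>R\<^esub> Y j) \<otimes>\<^bsub>R Quot P\<^esub> \<phi> k (f j))
       = (P +>\<^bsub>R\<^esub> Y i) \<otimes>\<^bsub>R Quot P\<^esub> \<phi> k (f i) \<oplus>\<^bsub>R Quot P\<^esub> (\<Oplus>\<^bsub>R Quot P\<^esub>j\<in>L. (P +>\<^bsub>R\<^esub> Y j) \<otimes>\<^bsub>R Quot P\<^esub> \<phi> k (f j))"
      using insert by (intro Q.finsum_insert) (auto simp: D(1))
    have IH: "\<phi> k (\<Oplus>\<^bsub>R\<^esub>j\<in>L. Y j \<otimes>\<^bsub>R\<^esub> f j) = (\<Oplus>\<^bsub>R Quot P\<^esub>j\<in>L. (P +>\<^bsub>R\<^esub> Y j) \<otimes>\<^bsub>R Quot P\<^esub> \<phi> k (f j))"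
      "(\<Oplus>\<^bsub>R\<^esub>j\<in>L. Y j \<otimes>\<^bsub>R\<^esub> f j) \<in> V" using insert by auto
    show ?case unfolding 1 2 using insert.prems IH
      by (simp add: D(2) D(3) V.I_l_closed)
  qed
qed

text \<open>If \<open>L\<close> were larger, a non-trivial combination of the \<open>f j\<close>
  would be annihilated by every \<open>\<phi> k\<close> and so lie in \<open>W\<close>. Then every
  \<open>\<psi> l\<close> annihilates it as well, although \<open>\<psi> l\<close> reads off its
  coefficient at \<open>l\<close>. The two systems share \<open>V\<close> and \<open>W\<close> but
  may be unrelated otherwise.\<close>

lemma dual_system_card_le:
  assumes "primeideal P R" "ideal V R" "finite K" "finite L"
    and K: "dual_system R P V W K \<phi> e" and L: "dual_system R P V W L \<psi> f"
  shows "card L \<le> card K"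
proof (rule ccontr)
  assume "\<not> card L \<le> card K"
  interpret primeideal P R by fact
  interpret Q: "domain" "R Quot P" by (rule quotient_is_domain)
  have fV: "\<And>j. j \<in> L \<Longrightarrow> f j \<in> V" using L unfolding dual_system_def by blast
  have "\<And>j k. j \<in> L \<Longrightarrow> k \<in> K \<Longrightarrow> \<phi> k (f j) \<in> carrier (R Quot P)"
    using K fV unfolding dual_system_def by blast
  then obtain y where y: "\<forall>j\<in>L. y j \<in> carrier (R Quot P)" "\<exists>j\<in>L. y j \<noteq> \<zero>\<^bsub>R Quot P\<^esub>"
    "\<forall>k\<in>K. (\<Oplus>\<^bsub>R Quot P\<^esub>j\<in>L. y j \<otimes>\<^bsub>R Quot P\<^esub> \<phi> k (f j)) = \<zero>\<^bsub>R Quot P\<^esub>"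
    using Q.underdetermined_system[of K L "\<lambda>j k. \<phi> k (f j)"] assms(3,4) \<open>\<not> card L \<le> card K\<close> by auto
  \<comment> \<open>The solution lies in the quotient while the \<open>f j\<close> are elements of
    the ring, so the coefficients are lifted.\<close>
  have "\<forall>j\<in>L. \<exists>c\<in>carrier R. y j = P +>\<^bsub>R\<^esub> c"
    using y(1) by (auto simp: FactRing_def A_RCOSETS_def')
  then obtain Y where Y: "\<And>j. j \<in> L \<Longrightarrow> Y j \<in> carrier R" "\<And>j. j \<in> L \<Longrightarrow> y j = P +>\<^bsub>R\<^esub> Y j"
    by metis
  define v where "v = (\<Oplus>\<^bsub>R\<^esub>j\<in>L. Y j \<otimes>\<^bsub>R\<^esub> f j)"
  have vV: "v \<in> V" if "k \<in> L" for k
    unfolding v_def using dual_system_finsum[where Y=Y and f=f, OF assms(1,2) L that assms(4) Y(1) fV] by blast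
  have "\<phi> k v = \<zero>\<^bsub>R Quot P\<^esub>" if k: "k \<in> K" for k
  proof -
    have "\<phi> k v = (\<Oplus>\<^bsub>R Quot P\<^esub>j\<in>L. (P +>\<^bsub>R\<^esub> Y j) \<otimes>\<^bsub>R Quot P\<^esub> \<phi> k (f j))"
      unfolding v_def using dual_system_finsum[where Y=Y and f=f, OF assms(1,2) K k assms(4) Y(1) fV] by blast
    also have "\<dots> = (\<Oplus>\<^bsub>R Quot P\<^esub>j\<in>L. y j \<otimes>\<^bsub>R Quot P\<^esub> \<phi> k (f j))"
      using Y(2) y(1) \<open>\<And>j k. j \<in> L \<Longrightarrow> k \<in> K \<Longrightarrow> \<phi> k (f j) \<in> carrier (R Quot P)\<close> k
      by (intro Q.finsum_cong') auto
    finally show ?thesis using y(3) k by simp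
  qed
  moreover obtain l where l: "l \<in> L" "y l \<noteq> \<zero>\<^bsub>R Quot P\<^esub>" using y by blast
  ultimately have "v \<in> W" using K vV[OF l(1)] unfolding dual_system_def by blast
  then have "\<psi> l v = \<zero>\<^bsub>R Quot P\<^esub>" using L vV[OF l(1)] l unfolding dual_system_def by blast
  moreover have "\<psi> l v = (\<Oplus>\<^bsub>R Quot P\<^esub>j\<in>L. (P +>\<^bsub>R\<^esub> Y j) \<otimes>\<^bsub>R Quot P\<^esub> \<psi> l (f j))"
    unfolding v_def using dual_system_finsum[where Y=Y and f=f, OF assms(1,2) L l(1) assms(4) Y(1) fV] by blast
  moreover have "\<dots> = (\<Oplus>\<^bsub>R Quot P\<^esub>j\<in>L. if l = j then y j else \<zero>\<^bsub>R Quot P\<^esub>)"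
  proof (intro Q.finsum_cong')
    fix j assume j: "j \<in> L"
    have "\<psi> l (f j) = (if l = j then \<one>\<^bsub>R Quot P\<^esub> else \<zero>\<^bsub>R Quot P\<^esub>)"
      using L l j unfolding dual_system_def by blast
    then show "(P +>\<^bsub>R\<^esub> Y j) \<otimes>\<^bsub>R Quot P\<^esub> \<psi> l (f j) = (if l = j then y j else \<zero>\<^bsub>R Quot P\<^esub>)"
      using Y(2)[OF j] y(1) j by (metis Q.r_null Q.r_one)
  qed (use y in auto)
  moreover have "\<dots> = y l"
    using Q.finsum_singleton[of l L y] l assms(4) y by auto
  ultimately show False using l by simp
qed

section \<open>Homogeneous elements of the fiber cone\<close>

lemma (in cring) ideal_prod_cgenideal:
  assumes "ideal K R" "u \<in> carrier R"
  shows "K \<cdot> (PIdl u) = (\<lambda>c. c \<otimes> u) ` K"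
proof -
  interpret K: ideal K R by fact
  show ?thesis
  proof safe
    fix x assume "x \<in> K \<cdot> (PIdl u)"
    then show "x \<in> (\<lambda>c. c \<otimes> u) ` K"
    proof induction
      case (prod i j)
      then obtain d where d: "d \<in> carrier R" "j = d \<otimes> u" by (auto simp: cgenideal_def)
      have "i \<otimes> j = (i \<otimes> d) \<otimes> u" using d assms prod by (simp add: m_assoc K.Icarr)
      then show ?case using K.I_r_closed[OF prod(1) d(1)] by blast
    next
      case (sum s t)
      then obtain c d where "c \<in> K" "d \<in> K" "s = c \<otimes> u" "t = d \<otimes> u" by blast
      then have "s \<oplus> t = (c \<oplus> d) \<otimes> u" "c \<oplus> d \<in> K" using assms by (auto simp: l_distr K.Icarr)
      then show ?case by blast
    qed
  next
    fix c assume "c \<in> K"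
    then show "c \<otimes> u \<in> K \<cdot> (PIdl u)" using assms cgenideal_self by (intro ideal_prod.prod) auto
  qed
qed

lemma (in cring) ideal_pow_simps:
  "ideal_pow R L 0 = carrier R" "ideal_pow R L (Suc n) = ideal_pow R L n \<cdot> L"
  by (auto simp: ideals_set_def nat_pow_def)

lemma (in cring) ideal_pow_ideal: "ideal L R \<Longrightarrow> ideal (ideal_pow R L n) R"
  by (induction n) (simp_all only: ideal_pow_simps oneideal ideal_prod_is_ideal)

lemma (in cring) ideal_pow_add:
  assumes "ideal L R"
  shows "ideal_pow R L (i + j) = ideal_pow R L i \<cdot> ideal_pow R L j"
proof -
  interpret S: comm_monoid "ideals_set R" by (rule ideals_set_is_comm_monoid)
  have "L \<in> carrier (ideals_set R)" using assms by (simp add: ideals_set_def)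
  from S.nat_pow_mult[OF this, of i j] show ?thesis by (simp add: ideals_set_def)
qed

lemma (in cring) ideal_pow_1: "ideal L R \<Longrightarrow> ideal_pow R L 1 = L"
  using ideal_pow_simps(2)[of L 0] ideal_pow_simps(1)[of L] by (simp add: ideal_prod_one ideal_prod_commute oneideal)

lemma (in cring) ideal_pow_cgenideal:
  assumes "u \<in> carrier R"
  shows "ideal_pow R (PIdl u) n = (\<lambda>c. c \<otimes> u [^] n) ` carrier R"
proof (induction n)
  case 0 then show ?case by (auto simp: ideals_set_def image_iff)
next
  case (Suc n)
  have "ideal (ideal_pow R (PIdl u) n) R" using assms by (simp add: ideal_pow_ideal cgenideal_ideal)
  then have "ideal_pow R (PIdl u) (Suc n) = (\<lambda>c. c \<otimes> u) ` (\<lambda>c. c \<otimes> u [^] n) ` carrier R"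
    using assms by (simp only: ideal_pow_simps ideal_prod_cgenideal Suc)
  also have "\<dots> = (\<lambda>c. c \<otimes> u [^] Suc n) ` carrier R"
    using assms by (auto simp: image_image m_assoc intro!: image_cong)
  finally show ?case .
qed

lemma (in cring) ideal_pow_mono:
  assumes "J \<subseteq> L" "ideal J R" "ideal L R" 
  shows "ideal_pow R J n \<subseteq> ideal_pow R L n"
proof (induction n)
  case (Suc n)
  show ?case unfolding ideal_pow_simps
  proof
    fix x assume "x \<in> ideal_pow R J n \<cdot> J"
    then show "x \<in> ideal_pow R L n \<cdot> L"
      by induction (use Suc assms(1) in \<open>auto intro: ideal_prod.intros\<close>)
  qed
qed simp

text \<open>The class of \<open>u\<close> placed in degree \<open>p\<close>. The unit of the fiber
  cone is the case of \<open>\<one>\<close> in degree 0, and \<open>fiber_class\<close> is the case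
  \<open>p = 1\<close>.\<close>

definition fiber_mono where
  "fiber_mono R \<mm> L p u = (\<lambda>n. if n = p then fiber_den R \<mm> L p +>\<^bsub>R\<^esub> u else fiber_den R \<mm> L n)"

text \<open>Instantiated both with \<open>I\<close> and with the principal ideal of
  \<open>a\<close>, so that the same facts serve \<open>F(I)\<close> and
  \<open>F(J)\<close>.\<close>

locale ideal_in_cring = cring R for R (structure) +
  fixes \<mm> L :: "'a set"
  assumes m_ideal: "ideal \<mm> R" and L_ideal: "ideal L R"
begin

abbreviation "pw n \<equiv> ideal_pow R L n"
abbreviation "den n \<equiv> fiber_den R \<mm> L n"
abbreviation "hm p u \<equiv> fiber_mono R \<mm> L p u"
abbreviation "FC \<equiv> fiber_cone R \<mm> L"

lemma pw_ideal: "ideal (pw n) R" by (rule ideal_pow_ideal[OF L_ideal])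

lemma den_ideal: "ideal (den n) R"
  unfolding fiber_den_def by (rule ideal_prod_is_ideal[OF m_ideal pw_ideal])

lemma den_subset: "den n \<subseteq> pw n"
  unfolding fiber_den_def using ideal_prod_inter[OF m_ideal pw_ideal] by blast

lemma pw_carr: "x \<in> pw n \<Longrightarrow> x \<in> carrier R" using ideal.Icarr[OF pw_ideal] .

lemma pw_closed [simp]:
  "x \<in> pw n \<Longrightarrow> y \<in> pw n \<Longrightarrow> x \<oplus> y \<in> pw n"
  "c \<in> carrier R \<Longrightarrow> x \<in> pw n \<Longrightarrow> c \<otimes> x \<in> pw n"
  "\<zero> \<in> pw n"
  using ideal.I_l_closed[OF pw_ideal] additive_subgroup.a_closed[OF ideal.axioms(1)[OF pw_ideal]]
    additive_subgroup.zero_closed[OF ideal.axioms(1)[OF pw_ideal]] by auto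

lemma pw_mult: "x \<in> pw i \<Longrightarrow> y \<in> pw j \<Longrightarrow> x \<otimes> y \<in> pw (i + j)"
  by (simp add: ideal_pow_add L_ideal ideal_prod.prod)

lemma den_mult: assumes "x \<in> den i" "y \<in> pw j" shows "x \<otimes> y \<in> den (i + j)"
proof -
  have "den (i + j) = den i \<cdot> pw j"
    by (simp add: fiber_den_def ideal_pow_add L_ideal ideal_prod_assoc m_ideal pw_ideal)
  with assms show ?thesis by (simp add: ideal_prod.prod)
qed

lemma den_mult_r: "x \<in> pw i \<Longrightarrow> y \<in> den j \<Longrightarrow> x \<otimes> y \<in> den (i + j)"
  using den_mult[of y j x i] m_comm[of x y] pw_carr ideal.Icarr[OF den_ideal] by (simp add: add.commute)

lemma pow_pw: "u \<in> L \<Longrightarrow> u [^] n \<in> pw n"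
  by (induction n) (simp_all only: ideal_pow_simps nat_pow_Suc nat_pow_0 one_closed ideal_prod.prod)

lemma coset_eq: "x \<in> carrier R \<Longrightarrow> y \<in> carrier R \<Longrightarrow> den n +> x = den n +> y \<longleftrightarrow> x \<ominus> y \<in> den n"
  using quotient_eq_iff_same_a_r_cos[OF den_ideal] by blast

lemma coset_zero_iff: "x \<in> carrier R \<Longrightarrow> den n +> x = den n \<longleftrightarrow> x \<in> den n"
  using a_rcos_zero[OF den_ideal] ideal.rcos_const_imp_mem[OF den_ideal] by blast

lemma coset_zero [simp]: "den n +> \<zero> = den n"
  using coset_zero_iff additive_subgroup.zero_closed[OF ideal.axioms(1)[OF den_ideal]] by simp

lemma coset_add:
  "x \<in> carrier R \<Longrightarrow> y \<in> carrier R \<Longrightarrow> (den n +> x) <+> (den n +> y) = den n +> (x \<oplus> y)"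
  using ideal.a_rcos_sum[OF den_ideal] .

lemma coset_subset: "x \<in> pw n \<Longrightarrow> den n +> x \<subseteq> pw n"
  using subsetD[OF den_subset] by (auto simp: a_r_coset_def')

text \<open>Changing representatives by \<open>c\<close> and \<open>d\<close> changes the product by
  \<open>c \<otimes> b \<oplus> x \<otimes> d\<close>, which lies in the denominator of degree
  \<open>i + j\<close>. As \<open>rcoset_mult\<close> is a union over all representatives, all
  members of the union coincide, and the union is not empty.\<close>

lemma coset_mult:
  assumes "x \<in> pw i" "y \<in> pw j"
  shows "rcoset_mult R (den (i + j)) (den i +> x) (den j +> y) = den (i + j) +> (x \<otimes> y)"
proof -
  have "den (i + j) +> a \<otimes> b = den (i + j) +> x \<otimes> y" if ab: "a \<in> den i +> x" "b \<in> den j +> y" for a b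
  proof -
    obtain c d where c: "c \<in> den i" "a = c \<oplus> x" and d: "d \<in> den j" "b = d \<oplus> y"
      using ab by (auto simp: a_r_coset_def')
    have carr: "c \<in> carrier R" "d \<in> carrier R" "x \<in> carrier R" "y \<in> carrier R"
      using c d assms pw_carr ideal.Icarr[OF den_ideal] by auto
    have "b \<in> pw j" using d assms subsetD[OF den_subset] by auto
    then have 1: "c \<otimes> b \<in> den (i + j)" "x \<otimes> d \<in> den (i + j)"
      using c d assms den_mult den_mult_r by auto
    have "a \<otimes> b \<ominus> x \<otimes> y = c \<otimes> b \<oplus> x \<otimes> d"
      unfolding c d using carr by algebra
    then have "a \<otimes> b \<ominus> x \<otimes> y \<in> den (i + j)"
      using 1 additive_subgroup.a_closed[OF ideal.axioms(1)[OF den_ideal]] by auto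
    then show ?thesis using c d carr by (subst coset_eq) auto
  qed
  moreover have "x \<in> den i +> x" "y \<in> den j +> y"
    using assms pw_carr abelian_subgroup.a_rcos_self[OF abelian_subgroupI3[OF ideal.axioms(1)[OF den_ideal] is_abelian_group]]
    by auto
  ultimately show ?thesis unfolding rcoset_mult_def by blast
qed

lemma FC_simps:
  "f \<oplus>\<^bsub>FC\<^esub> g = (\<lambda>n. f n <+> g n)" "\<zero>\<^bsub>FC\<^esub> = den"
  by (auto simp: fiber_cone_def)

lemma FC_carrier:
  "f \<in> carrier FC \<longleftrightarrow> (\<forall>n. f n \<in> (\<lambda>x. den n +> x) ` pw n) \<and> finite {n. f n \<noteq> den n}"
  by (simp add: fiber_cone_def)

lemma mono_closed: "u \<in> pw p \<Longrightarrow> hm p u \<in> carrier FC"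
proof -
  assume u: "u \<in> pw p"
  have "{n. hm p u n \<noteq> den n} \<subseteq> {p}" by (auto simp: fiber_mono_def)
  moreover have "den n \<in> (+>) (den n) ` pw n" for n
    by (rule image_eqI[of _ _ \<zero>]) auto
  ultimately show ?thesis using u by (auto simp: FC_carrier fiber_mono_def intro: finite_subset)
qed

text \<open>In the convolution only the index \<open>i = p\<close> survives, because all other
  components of the left factor vanish. For \<open>n < p\<close> this index does not occur.\<close>

lemma mono_mult:
  assumes "u \<in> pw p" "f \<in> carrier FC"
  shows "(hm p u \<otimes>\<^bsub>FC\<^esub> f) n = (if n < p then den n else rcoset_mult R (den n) (den p +> u) (f (n - p)))"
proof -
  interpret D: ideal "den n" R by (rule den_ideal)
  interpret Q: cring "R Quot den n" by (rule D.quotient_is_cring[OF is_cring])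
  have t: "\<exists>y\<in>pw (n - i). f (n - i) = den (n - i) +> y" for i
    using assms(2) by (auto simp: FC_carrier)
  have u: "u \<in> carrier R" using assms pw_carr by blast
  have z: "\<zero>\<^bsub>R Quot den n\<^esub> = den n" by (simp add: FactRing_def)
  have c: "rcoset_mult R (den n) (den p +> u) (f (n - p)) \<in> carrier (R Quot den n)" if np: "p \<le> n"
  proof -
    obtain y where y: "y \<in> pw (n - p)" "f (n - p) = den (n - p) +> y" using t by blast
    have "rcoset_mult R (den n) (den p +> u) (f (n - p)) = den n +> (u \<otimes> y)"
      using coset_mult[OF assms(1) y(1)] y np by simp
    then show ?thesis using u y pw_carr by (auto simp: FactRing_def A_RCOSETS_def')
  qed
  have e: "rcoset_mult R (den n) (hm p u i) (f (n - i)) =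
     (if p = i then rcoset_mult R (den n) (den p +> u) (f (n - p)) else \<zero>\<^bsub>R Quot den n\<^esub>)" if "i \<le> n" for i
  proof (cases "p = i")
    case False
    obtain y where y: "y \<in> pw (n - i)" "f (n - i) = den (n - i) +> y" using t by blast
    \<comment> \<open>The vanishing component is written as the class of \<open>\<zero>\<close>, so
      that \<open>coset_mult\<close> evaluates the product.\<close>
    have "rcoset_mult R (den n) (hm p u i) (f (n - i)) = rcoset_mult R (den (i + (n - i))) (den i +> \<zero>) (den (n - i) +> y)"
      using False that y by (simp add: fiber_mono_def)
    also have "\<dots> = den (i + (n - i)) +> (\<zero> \<otimes> y)" using y by (intro coset_mult) auto
    finally show ?thesis using False that y z pw_carr by simp
  qed (simp add: fiber_mono_def)
  have "(hm p u \<otimes>\<^bsub>FC\<^esub> f) n = (\<Oplus>\<^bsub>R Quot den n\<^esub>i\<in>{..n}. rcoset_mult R (den n) (hm p u i) (f (n - i)))"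
    by (simp add: fiber_cone_def)
  also have "\<dots> = (\<Oplus>\<^bsub>R Quot den n\<^esub>i\<in>{..n}. if p = i then rcoset_mult R (den n) (den p +> u) (f (n - p)) else \<zero>\<^bsub>R Quot den n\<^esub>)"
    using e c by (intro Q.finsum_cong') auto
  also have "\<dots> = (if n < p then den n else rcoset_mult R (den n) (den p +> u) (f (n - p)))"
  proof (cases "n < p")
    case True
    have "(\<Oplus>\<^bsub>R Quot den n\<^esub>i\<in>{..n}. if p = i then rcoset_mult R (den n) (den p +> u) (f (n - p)) else \<zero>\<^bsub>R Quot den n\<^esub>)
      = (\<Oplus>\<^bsub>R Quot den n\<^esub>i\<in>{..n}. \<zero>\<^bsub>R Quot den n\<^esub>)"
      using True by (intro Q.finsum_cong') auto
    then show ?thesis using True z Q.finsum_zero by simp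
  next
    case False
    then show ?thesis
      using Q.finsum_singleton[of p "{..n}" "\<lambda>_. rcoset_mult R (den n) (den p +> u) (f (n - p))"] c by auto
  qed
  finally show ?thesis .
qed

lemma mono_mult_mono:
  assumes "u \<in> pw p" "v \<in> pw q"
  shows "hm p u \<otimes>\<^bsub>FC\<^esub> hm q v = hm (p + q) (u \<otimes> v)"
proof
  fix n
  have uv: "u \<in> carrier R" "v \<in> carrier R" using assms pw_carr by auto
  show "(hm p u \<otimes>\<^bsub>FC\<^esub> hm q v) n = hm (p + q) (u \<otimes> v) n"
  proof (cases "n < p")
    case True
    then show ?thesis using assms by (simp add: mono_mult mono_closed) (simp add: fiber_mono_def)
  next
    case False
    then obtain k where k: "n = p + k" using le_Suc_ex not_less by blast
    show ?thesis
    proof (cases "k = q")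
      case True
      then show ?thesis using assms k coset_mult[OF assms] by (simp add: mono_mult mono_closed) (simp add: fiber_mono_def)
    next
      case F: False
      have "hm q v k = den k +> \<zero>" using F by (simp add: fiber_mono_def)
      then have "(hm p u \<otimes>\<^bsub>FC\<^esub> hm q v) n = den n"
        using assms k coset_mult[OF assms(1), of \<zero> k] uv by (simp add: mono_mult mono_closed)
      then show ?thesis using F k by (simp add: fiber_mono_def)
    qed
  qed
qed

lemma mono_add:
  assumes "u \<in> pw p" "v \<in> pw p"
  shows "hm p u \<oplus>\<^bsub>FC\<^esub> hm p v = hm p (u \<oplus> v)"
proof
  fix n
  have "den n <+> den n = den n" using coset_add[of \<zero> \<zero> n] by simp
  then show "(hm p u \<oplus>\<^bsub>FC\<^esub> hm p v) n = hm p (u \<oplus> v) n"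
    using assms pw_carr by (simp add: FC_simps coset_add fiber_mono_def)
qed

lemma mono_zero_iff: "u \<in> pw p \<Longrightarrow> hm p u = \<zero>\<^bsub>FC\<^esub> \<longleftrightarrow> u \<in> den p"
  using coset_zero_iff[of u p] pw_carr by (auto simp: FC_simps fiber_mono_def fun_eq_iff)

lemma FC_one: "\<one>\<^bsub>FC\<^esub> = hm 0 \<one>"
  by (auto simp: fiber_cone_def fiber_mono_def)

lemma fiber_class_pow:
  assumes "u \<in> L"
  shows "fiber_class R \<mm> L u [^]\<^bsub>FC\<^esub> j = hm j (u [^] j)"
proof (induction j)
  case 0 show ?case by (simp add: nat_pow_def FC_one)
next
  case (Suc j)
  have "fiber_class R \<mm> L u = hm 1 u" unfolding fiber_class_def fiber_mono_def by (rule refl)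
  moreover have "u \<in> pw 1" using assms ideal_pow_1[OF L_ideal] by simp
  ultimately show ?case
    using Suc mono_mult_mono[OF pow_pw[OF assms, of j], of u 1] by (simp add: nat_pow_def)
qed

end

section \<open>Closure properties, commutativity and the module structure of the fiber cone\<close>

context ideal_in_cring
begin

lemma rcoset_mult_comm:
  assumes "U \<subseteq> carrier R" "V \<subseteq> carrier R"
  shows "rcoset_mult R D U V = rcoset_mult R D V U"
proof -
  have "D +> (x \<otimes> y) = D +> (y \<otimes> x)" if "x \<in> U" "y \<in> V" for x y
    using m_comm[of x y] subsetD[OF assms(1) that(1)] subsetD[OF assms(2) that(2)] by simp
  then show ?thesis unfolding rcoset_mult_def by blast
qed

lemma FC_coset: "f \<in> carrier FC \<Longrightarrow> \<exists>x\<in>pw n. f n = den n +> x"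
  by (auto simp: FC_carrier)

text \<open>Reversing the summation index exchanges the factors. This is needed because
  \<open>cgenideal\<close> puts the generator on the right, whereas \<open>mono_mult\<close>
  evaluates products with the homogeneous factor on the left.\<close>

lemma FC_comm:
  assumes "f \<in> carrier FC" "g \<in> carrier FC"
  shows "f \<otimes>\<^bsub>FC\<^esub> g = g \<otimes>\<^bsub>FC\<^esub> f"
proof
  fix n
  interpret D: ideal "den n" R by (rule den_ideal)
  interpret Q: cring "R Quot den n" by (rule D.quotient_is_cring[OF is_cring])
  have sub: "f i \<subseteq> carrier R" "g i \<subseteq> carrier R" for i
    using FC_coset[OF assms(1), of i] FC_coset[OF assms(2), of i] coset_subset pw_carr by blast+
  have cl: "rcoset_mult R (den n) (f i) (g (n - i)) \<in> carrier (R Quot den n)" if i: "i \<le> n" for i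
  proof -
    obtain x y where x: "x \<in> pw i" "f i = den i +> x" and y: "y \<in> pw (n - i)" "g (n - i) = den (n - i) +> y"
      using FC_coset[OF assms(1), of i] FC_coset[OF assms(2), of "n - i"] by blast
    have "rcoset_mult R (den n) (f i) (g (n - i)) = den n +> (x \<otimes> y)"
      using coset_mult[OF x(1) y(1)] x y i by simp
    then show ?thesis using x(1) y(1) pw_carr by (auto simp: FactRing_def A_RCOSETS_def')
  qed
  have im: "(\<lambda>i. n - i) ` {..n} = {..n}"
  proof (intro equalityI subsetI)
    fix i assume "i \<in> {..n}"
    then show "i \<in> (\<lambda>i. n - i) ` {..n}" by (intro image_eqI[of _ _ "n - i"]) auto
  qed auto
  have "(f \<otimes>\<^bsub>FC\<^esub> g) n = (\<Oplus>\<^bsub>R Quot den n\<^esub>i\<in>(\<lambda>i. n - i) ` {..n}. rcoset_mult R (den n) (f i) (g (n - i)))"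
    unfolding im by (simp add: fiber_cone_def)
  also have "\<dots> = (\<Oplus>\<^bsub>R Quot den n\<^esub>i\<in>{..n}. rcoset_mult R (den n) (f (n - i)) (g (n - (n - i))))"
  proof (rule Q.finsum_reindex[of "\<lambda>i. rcoset_mult R (den n) (f i) (g (n - i))" "\<lambda>i. n - i" "{..n}"])
    show "(\<lambda>i. rcoset_mult R (den n) (f i) (g (n - i))) \<in> (\<lambda>i. n - i) ` {..n} \<rightarrow> carrier (R Quot den n)"
      unfolding im using cl by blast
  qed (auto simp: inj_on_def)
  also have "\<dots> = (\<Oplus>\<^bsub>R Quot den n\<^esub>i\<in>{..n}. rcoset_mult R (den n) (g i) (f (n - i)))"
  proof (rule Q.finsum_cong')
    show "(\<lambda>i. rcoset_mult R (den n) (g i) (f (n - i))) \<in> {..n} \<rightarrow> carrier (R Quot den n)"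
    proof
      fix i assume "i \<in> {..n}"
      then show "rcoset_mult R (den n) (g i) (f (n - i)) \<in> carrier (R Quot den n)"
        using cl[of "n - i"] rcoset_mult_comm[OF sub, of "den n" "n - i" i] by simp
    qed
  qed (use rcoset_mult_comm[OF sub] in auto)
  also have "\<dots> = (g \<otimes>\<^bsub>FC\<^esub> f) n" by (simp add: fiber_cone_def)
  finally show "(f \<otimes>\<^bsub>FC\<^esub> g) n = (g \<otimes>\<^bsub>FC\<^esub> f) n" .
qed

lemma mono_mult_closed:
  assumes "u \<in> pw p" "f \<in> carrier FC"
  shows "hm p u \<otimes>\<^bsub>FC\<^esub> f \<in> carrier FC"
proof -
  \<comment> \<open>The second conjunct records that zero components go to zero components; it
    bounds the support of the product by a shift of the support of \<open>f\<close>.\<close>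
  have 1: "\<exists>x\<in>pw n. (hm p u \<otimes>\<^bsub>FC\<^esub> f) n = den n +> x \<and> (n < p \<or> f (n - p) = den (n - p) \<longrightarrow> den n +> x = den n)" for n
  proof (cases "n < p")
    case True
    then show ?thesis using assms by (intro bexI[of _ \<zero>]) (auto simp: mono_mult)
  next
    case False
    obtain y where y: "y \<in> pw (n - p)" "f (n - p) = den (n - p) +> y" using FC_coset assms by blast
    have "(hm p u \<otimes>\<^bsub>FC\<^esub> f) n = den n +> (u \<otimes> y)"
      using False coset_mult[OF assms(1) y(1)] y assms by (simp add: mono_mult)
    moreover have "u \<otimes> y \<in> pw n" using pw_mult[OF assms(1) y(1)] False by simp
    moreover have "u \<otimes> y \<in> den n" if "f (n - p) = den (n - p)"
      using that y den_mult_r[OF assms(1), of y "n - p"] coset_zero_iff pw_carr False by auto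
    ultimately show ?thesis using False coset_zero_iff pw_carr by blast
  qed
  have "n \<in> (\<lambda>k. k + p) ` {k. f k \<noteq> den k}" if "(hm p u \<otimes>\<^bsub>FC\<^esub> f) n \<noteq> den n" for n
    using 1[of n] that by (intro image_eqI[of _ _ "n - p"]) auto
  then have "{n. (hm p u \<otimes>\<^bsub>FC\<^esub> f) n \<noteq> den n} \<subseteq> (\<lambda>k. k + p) ` {k. f k \<noteq> den k}" by blast
  moreover have "finite {k. f k \<noteq> den k}" using assms by (simp add: FC_carrier)
  ultimately have "finite {n. (hm p u \<otimes>\<^bsub>FC\<^esub> f) n \<noteq> den n}" by (meson finite_imageI finite_subset)
  moreover have "(hm p u \<otimes>\<^bsub>FC\<^esub> f) n \<in> (+>) (den n) ` pw n" for n using 1[of n] by blast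
  ultimately show ?thesis unfolding FC_carrier by blast
qed

lemma FC_add_closed:
  assumes "f \<in> carrier FC" "g \<in> carrier FC"
  shows "f \<oplus>\<^bsub>FC\<^esub> g \<in> carrier FC"
proof -
  have "f n <+> g n \<in> (+>) (den n) ` pw n" for n
  proof -
    obtain x y where "x \<in> pw n" "f n = den n +> x" "y \<in> pw n" "g n = den n +> y"
      using FC_coset assms by meson
    then show ?thesis using coset_add[of x y n] pw_carr by auto
  qed
  moreover have "den n <+> den n = den n" for n using coset_add[of \<zero> \<zero> n] by simp
  then have "{n. f n <+> g n \<noteq> den n} \<subseteq> {n. f n \<noteq> den n} \<union> {n. g n \<noteq> den n}" by auto
  moreover have "finite ({n. f n \<noteq> den n} \<union> {n. g n \<noteq> den n})" using assms by (simp add: FC_carrier)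
  ultimately show ?thesis unfolding FC_carrier FC_simps by (meson finite_subset)
qed

text \<open>Serves to show that additive maps preserve zero: the image of \<open>0 = 0 + 0\<close>
  is idempotent.\<close>

lemma FC_add_idem:
  assumes "f \<in> carrier FC" "f \<oplus>\<^bsub>FC\<^esub> f = f"
  shows "f = \<zero>\<^bsub>FC\<^esub>"
proof
  fix n
  obtain x where x: "x \<in> pw n" "f n = den n +> x" using FC_coset assms(1) by blast
  have xc: "x \<in> carrier R" using x pw_carr by auto
  have "(f \<oplus>\<^bsub>FC\<^esub> f) n = den n +> (x \<oplus> x)" using x xc by (simp add: FC_simps coset_add)
  then have "den n +> (x \<oplus> x) = den n +> x" using assms(2) x by simp
  then have "x \<oplus> x \<ominus> x \<in> den n" using coset_eq[of "x \<oplus> x" x n] xc by simp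
  moreover have "x \<oplus> x \<ominus> x = x" using xc by algebra
  ultimately show "f n = \<zero>\<^bsub>FC\<^esub> n" using x xc by (simp add: FC_simps coset_zero_iff)
qed

lemma fiber_module_simps:
  "carrier (fiber_module R \<mm> L) = carrier FC"
  "x \<oplus>\<^bsub>fiber_module R \<mm> L\<^esub> y = x \<oplus>\<^bsub>FC\<^esub> y"
  "\<zero>\<^bsub>fiber_module R \<mm> L\<^esub> = \<zero>\<^bsub>FC\<^esub>"
  "s \<odot>\<^bsub>fiber_module R \<mm> L\<^esub> y = fiber_map R \<mm> L s \<otimes>\<^bsub>FC\<^esub> y"
  "homog (fiber_module R \<mm> L) n = {f \<in> carrier FC. \<forall>k. k \<noteq> n \<longrightarrow> f k = den k}"
  by (simp_all add: fiber_module_def Let_def)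

lemma homog_mono:
  assumes "f \<in> homog (fiber_module R \<mm> L) n"
  obtains x where "x \<in> pw n" "f = hm n x"
proof -
  have f: "f \<in> carrier FC" "\<And>k. k \<noteq> n \<Longrightarrow> f k = den k"
    using assms unfolding fiber_module_simps by blast+
  obtain x where x: "x \<in> pw n" "f n = den n +> x" using FC_coset[OF f(1)] by blast
  have "f k = hm n x k" for k using x(2) f(2)[of k] unfolding fiber_mono_def by (cases "k = n") simp_all
  then have "f = hm n x" by (rule ext)
  with x that show ?thesis by blast
qed

lemma mono_homog: "x \<in> pw n \<Longrightarrow> hm n x \<in> homog (fiber_module R \<mm> L) n"
  by (simp add: fiber_module_simps mono_closed) (simp add: fiber_mono_def)

text \<open>As \<open>\<mm>J^n \<subseteq> \<mm>L^n\<close>, adding the larger denominator absorbs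
  the smaller one. The action of a homogeneous scalar of \<open>F(J)\<close> thereby becomes
  multiplication by the same \<open>u\<close> in \<open>F(L)\<close>; the case \<open>J = L\<close>
  is used as well.\<close>

lemma fiber_map_mono:
  assumes "ideal J R" "J \<subseteq> L" "u \<in> ideal_pow R J p"
  shows "fiber_map R \<mm> L (fiber_mono R \<mm> J p u) = hm p u"
proof -
  interpret J: ideal_in_cring R \<mm> J by (intro ideal_in_cring.intro ideal_in_cring_axioms.intro is_cring m_ideal assms)
  have den_mono: "J.den n \<subseteq> den n" for n
  proof
    fix x assume "x \<in> J.den n"
    then show "x \<in> den n" unfolding fiber_den_def
    proof induction
      case (prod i j)
      then show ?case using ideal_pow_mono[OF assms(2,1) L_ideal] by (blast intro: ideal_prod.prod)
    qed (rule ideal_prod.sum)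
  qed
  have D: "x \<in> den n \<Longrightarrow> x \<in> carrier R" "x \<in> den n \<Longrightarrow> y \<in> den n \<Longrightarrow> x \<oplus> y \<in> den n" for x y n
    using ideal.Icarr[OF den_ideal] additive_subgroup.a_closed[OF ideal.axioms(1)[OF den_ideal]] by auto
  have *: "set_add R (den n) (J.den n +> v) = den n +> v" if v: "v \<in> carrier R" for n v
  proof (intro equalityI subsetI)
    fix x assume "x \<in> set_add R (den n) (J.den n +> v)"
    then obtain d e where de: "d \<in> den n" "e \<in> den n" "x = d \<oplus> (e \<oplus> v)"
      using den_mono by (auto simp: set_add_def' a_r_coset_def')
    then have "x = (d \<oplus> e) \<oplus> v" using D v by (simp add: a_assoc)
    then show "x \<in> den n +> v" using D de by (auto simp: a_r_coset_def')
  next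
    fix x assume "x \<in> den n +> v"
    then obtain d where d: "d \<in> den n" "x = d \<oplus> v" by (auto simp: a_r_coset_def')
    moreover have "v \<in> J.den n +> v"
      using abelian_subgroup.a_rcos_self[OF abelian_subgroupI3[OF ideal.axioms(1)[OF J.den_ideal] is_abelian_group]] v by simp
    ultimately show "x \<in> set_add R (den n) (J.den n +> v)" by (auto simp: set_add_def')
  qed
  show ?thesis
  proof
    fix n
    show "fiber_map R \<mm> L (fiber_mono R \<mm> J p u) n = hm p u n"
      using *[of \<zero> n] *[of u n] J.pw_carr[OF assms(3)] by (auto simp: fiber_map_def fiber_mono_def)
  qed
qed

end

section \<open>Fiber cones of regular principal ideals\<close>

locale principal_regular = cring R for R (structure) +
  fixes \<mm> :: "'a set" and a :: 'a
  assumes m_prime: "primeideal \<mm> R" and a_carr: "a \<in> carrier R"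
    and a_regular: "y \<in> carrier R \<Longrightarrow> a \<otimes> y = \<zero> \<Longrightarrow> y = \<zero>"
begin

abbreviation "J \<equiv> PIdl a"

sublocale ideal_in_cring R \<mm> J
  by (intro ideal_in_cring.intro ideal_in_cring_axioms.intro is_cring cgenideal_ideal a_carr
      primeideal.axioms(1)[OF m_prime])

lemma a_J: "a \<in> J" by (rule cgenideal_self[OF a_carr])

lemma pow_carr [simp]: "a [^] (n::nat) \<in> carrier R" using a_carr by simp

lemma pow_regular: "y \<in> carrier R \<Longrightarrow> a [^] (n::nat) \<otimes> y = \<zero> \<Longrightarrow> y = \<zero>"
proof (induction n)
  case (Suc n)
  then have "a \<otimes> (a [^] n \<otimes> y) = \<zero>" using a_carr by (simp add: m_ac)
  then show ?case using a_regular[of "a [^] n \<otimes> y"] Suc a_carr by simp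
qed simp

lemma pow_cancel:
  assumes "c \<in> carrier R" "d \<in> carrier R" "c \<otimes> a [^] (n::nat) = d \<otimes> a [^] n"
  shows "c = d"
proof -
  have "a [^] n \<otimes> (c \<ominus> d) = c \<otimes> a [^] n \<ominus> d \<otimes> a [^] n"
    using assms(1,2) pow_carr[of n] by algebra
  also have "\<dots> = \<zero>" using assms by simp
  finally have "c \<ominus> d = \<zero>" using pow_regular[of "c \<ominus> d" n] assms by simp
  then show ?thesis using assms by simp
qed

lemma pw_principal: "pw n = (\<lambda>c. c \<otimes> a [^] n) ` carrier R"
  by (rule ideal_pow_cgenideal[OF a_carr])

lemma den_principal: "den n = (\<lambda>c. c \<otimes> a [^] n) ` \<mm>"
proof -
  have "pw n = PIdl (a [^] n)" unfolding pw_principal by (auto simp: cgenideal_def)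
  then show ?thesis unfolding fiber_den_def using ideal_prod_cgenideal[OF m_ideal] by simp
qed

lemma den_principal_iff: "c \<in> carrier R \<Longrightarrow> c \<otimes> a [^] n \<in> den n \<longleftrightarrow> c \<in> \<mm>"
  unfolding den_principal using pow_cancel ideal.Icarr[OF m_ideal] by blast

lemma FC_principal: "f \<in> carrier FC \<Longrightarrow> \<exists>c\<in>carrier R. f n = den n +> c \<otimes> a [^] n"
  using FC_coset[of f n] unfolding pw_principal by blast

lemma pw_principal_mem [simp]: "c \<in> carrier R \<Longrightarrow> c \<otimes> a [^] n \<in> pw n" "a [^] n \<in> pw n"
  unfolding pw_principal by (blast, rule image_eqI[of _ _ \<one>]) auto

text \<open>As \<open>a\<close> is regular, multiplication by \<open>a\<^sup>n\<close> identifies \<open>R/\<mm>\<close> with \<open>J\<^sup>n/\<mm>J\<^sup>n\<close>; \<open>coord n\<close> is the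
  inverse.\<close>

definition coord :: "nat \<Rightarrow> 'a set \<Rightarrow> 'a set" where
  "coord n C = {c \<in> carrier R. den n +> c \<otimes> a [^] n = C}"

text \<open>Two coefficients \<open>c\<close> and \<open>d\<close> give the same class iff
  \<open>(d - c) a^n \<in> \<mm>J^n\<close>, and cancelling the regular element \<open>a^n\<close>
  turns this into \<open>d - c \<in> \<mm>\<close>.\<close>

lemma coord_coset:
  assumes "c \<in> carrier R"
  shows "coord n (den n +> c \<otimes> a [^] n) = \<mm> +> c"
proof -
  interpret M: abelian_subgroup \<mm> R by (rule abelian_subgroupI3[OF ideal.axioms(1)[OF m_ideal] is_abelian_group])
  have "den n +> d \<otimes> a [^] n = den n +> c \<otimes> a [^] n \<longleftrightarrow> d \<in> \<mm> +> c" if d: "d \<in> carrier R" for d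
  proof -
    have "d \<otimes> a [^] n \<ominus> c \<otimes> a [^] n = (d \<ominus> c) \<otimes> a [^] n" using d assms pow_carr[of n] by algebra
    then show ?thesis using d assms den_principal_iff[of "d \<ominus> c" n] M.a_rcos_module_minus[OF ring_axioms, of c d]
      by (simp add: coset_eq)
  qed
  moreover have "\<mm> +> c \<subseteq> carrier R" using a_r_coset_subset_G[OF _ assms] M.a_subset by blast
  ultimately show ?thesis unfolding coord_def by blast
qed

text \<open>This is the ideal \<open>a^j F(J)\<close>, as \<open>PIdl_class_pow\<close> shows.
  Described by vanishing components, it allows cosets to be computed degree by degree.\<close>

definition low_zero :: "nat \<Rightarrow> (nat \<Rightarrow> 'a set) set" where
  "low_zero j = {f \<in> carrier FC. \<forall>n<j. f n = den n}"

lemma mono_mult_low_zero: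
  assumes "f \<in> carrier FC" "j \<le> p" "u \<in> pw p"
  shows "hm p u \<otimes>\<^bsub>FC\<^esub> f \<in> low_zero j"
  using assms mono_mult_closed by (auto simp: low_zero_def mono_mult)

text \<open>Every component of degree \<open>n\<close> is the class of some \<open>c a^n\<close>; if
  \<open>n \<ge> j\<close>, the factor \<open>a^j\<close> can be split off. So vanishing below
  degree \<open>j\<close> is the same as divisibility by \<open>a^j\<close>.\<close>

lemma PIdl_class_pow:
  "PIdl\<^bsub>FC\<^esub> (fiber_class R \<mm> J a [^]\<^bsub>FC\<^esub> j) = low_zero j"
proof (intro equalityI subsetI)
  fix f assume "f \<in> PIdl\<^bsub>FC\<^esub> (fiber_class R \<mm> J a [^]\<^bsub>FC\<^esub> j)"
  then obtain g where g: "g \<in> carrier FC" "f = g \<otimes>\<^bsub>FC\<^esub> hm j (a [^] j)"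
    unfolding cgenideal_def[of FC] fiber_class_pow[OF a_J] by blast
  then show "f \<in> low_zero j"
    using FC_comm[OF g(1) mono_closed[of "a [^] j" j]] mono_mult_low_zero[of g j j "a [^] j"] by simp
next
  fix f assume f: "f \<in> low_zero j"
  then have fc: "f \<in> carrier FC" by (simp add: low_zero_def)
  obtain c where c: "\<And>n. c n \<in> carrier R" "\<And>n. f n = den n +> c n \<otimes> a [^] n"
    using FC_principal[OF fc] by metis
  \<comment> \<open>The quotient of \<open>f\<close> by \<open>a^j\<close>: the coefficient of
    degree \<open>n + j\<close> moves to degree \<open>n\<close>. Its support is finite because, by
    regularity of \<open>a\<close>, a coefficient outside \<open>\<mm>\<close> also gives a non-zero
    component of \<open>f\<close>.\<close>
  define g where "g n = den n +> c (n + j) \<otimes> a [^] n" for n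
  have "n \<in> (\<lambda>k. k - j) ` {k. f k \<noteq> den k}" if n: "g n \<noteq> den n" for n
  proof -
    have "c (n + j) \<notin> \<mm>" using n c(1) by (simp add: g_def coset_zero_iff den_principal_iff)
    then have "f (n + j) \<noteq> den (n + j)" using c by (simp add: coset_zero_iff den_principal_iff)
    then show ?thesis by (intro image_eqI[of _ _ "n + j"]) auto
  qed
  then have "{n. g n \<noteq> den n} \<subseteq> (\<lambda>k. k - j) ` {k. f k \<noteq> den k}" by blast
  moreover have "finite {k. f k \<noteq> den k}" using fc by (simp add: FC_carrier)
  ultimately have "finite {n. g n \<noteq> den n}" by (meson finite_imageI finite_subset)
  moreover have "g n \<in> (+>) (den n) ` pw n" for n using c(1) unfolding g_def by simp
  ultimately have gc: "g \<in> carrier FC" unfolding FC_carrier by blast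
  have "(hm j (a [^] j) \<otimes>\<^bsub>FC\<^esub> g) n = f n" for n
  proof (cases "n < j")
    case True
    then show ?thesis using f gc by (simp add: mono_mult low_zero_def)
  next
    case False
    then obtain k where k: "n = j + k" using le_Suc_ex not_less by blast
    have "(hm j (a [^] j) \<otimes>\<^bsub>FC\<^esub> g) n = den n +> (a [^] j \<otimes> (c n \<otimes> a [^] k))"
      using gc k c(1) coset_mult[of "a [^] j" j "c n \<otimes> a [^] k" k]
      by (simp add: mono_mult g_def add.commute[of k j])
    also have "a [^] j \<otimes> (c n \<otimes> a [^] k) = c n \<otimes> a [^] n"
      using c(1) a_carr k by (simp add: nat_pow_mult[symmetric] m_ac)
    finally show ?thesis using c by simp
  qed
  then have "f = g \<otimes>\<^bsub>FC\<^esub> hm j (a [^] j)"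
    using FC_comm[OF gc mono_closed[of "a [^] j" j]] by auto
  then show "f \<in> PIdl\<^bsub>FC\<^esub> (fiber_class R \<mm> J a [^]\<^bsub>FC\<^esub> j)"
    unfolding cgenideal_def[of FC] fiber_class_pow[OF a_J] using gc by blast
qed

lemma low_zero_add: "f \<in> low_zero j \<Longrightarrow> g \<in> low_zero j \<Longrightarrow> f \<oplus>\<^bsub>FC\<^esub> g \<in> low_zero j"
  using FC_add_closed[of f g] coset_add[of \<zero> \<zero>] by (simp add: low_zero_def) (simp add: FC_simps)

text \<open>An element \<open>w\<close> is recovered as \<open>(w - z) + z\<close>, where the
  negative of \<open>z\<close> is realised as its product with the class of
  \<open>\<ominus> \<one>\<close> in degree 0.\<close>

lemma low_zero_coset:
  assumes z: "z \<in> low_zero j"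
  shows "(\<Union>n\<in>low_zero j. {n \<oplus>\<^bsub>FC\<^esub> z}) = low_zero j"
proof (intro equalityI subsetI)
  fix w assume w: "w \<in> low_zero j"
  have zc: "z \<in> carrier FC" "w \<in> carrier FC" using z w by (auto simp: low_zero_def)
  have one: "\<ominus> \<one> \<in> pw 0" by (simp add: ideals_set_def)
  define z' where "z' = hm 0 (\<ominus> \<one>) \<otimes>\<^bsub>FC\<^esub> z"
  have z'v: "z' n = rcoset_mult R (den n) (den 0 +> \<ominus> \<one>) (z n)" for n
    unfolding z'_def using zc one by (simp add: mono_mult)
  have z': "z' n = den n +> \<ominus> x" if "x \<in> pw n" "z n = den n +> x" for n x
    using coset_mult[OF one that(1)] that pw_carr by (simp add: z'v l_minus)
  have "z' \<in> low_zero j"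
    using mono_mult_closed[OF one zc(1)] z'[of \<zero>] z unfolding low_zero_def z'_def[symmetric] by simp
  then have "w \<oplus>\<^bsub>FC\<^esub> z' \<in> low_zero j" using w low_zero_add by blast
  moreover have "w = (w \<oplus>\<^bsub>FC\<^esub> z') \<oplus>\<^bsub>FC\<^esub> z"
  proof
    fix n
    obtain x y where x: "x \<in> pw n" "z n = den n +> x" and y: "y \<in> pw n" "w n = den n +> y"
      using FC_coset zc by meson
    have [simp]: "x \<in> carrier R" "y \<in> carrier R" using x y pw_carr by auto
    have "((w \<oplus>\<^bsub>FC\<^esub> z') \<oplus>\<^bsub>FC\<^esub> z) n = den n +> (y \<oplus> \<ominus> x \<oplus> x)"
      using x(2) y(2) z'[OF x] by (simp add: FC_simps coset_add)
    also have "y \<oplus> \<ominus> x \<oplus> x = y" by (simp add: a_assoc l_neg)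
    finally show "w n = ((w \<oplus>\<^bsub>FC\<^esub> z') \<oplus>\<^bsub>FC\<^esub> z) n" using y by simp
  qed
  ultimately show "w \<in> (\<Union>n\<in>low_zero j. {n \<oplus>\<^bsub>FC\<^esub> z})" by blast
qed (use z low_zero_add in blast)

abbreviation "FM \<equiv> fiber_module R \<mm> J"

lemma FM_smult: "u \<in> pw p \<Longrightarrow> hm p u \<odot>\<^bsub>FM\<^esub> f = hm p u \<otimes>\<^bsub>FC\<^esub> f"
  using fiber_map_mono[OF L_ideal] by (simp add: fiber_module_simps)

text \<open>For \<open>p \<ge> j\<close> multiplication by \<open>a^p\<close> maps
  \<open>F(J)\<close> into \<open>a^j F(J)\<close>, which is the zero of the quotient.\<close>

lemma quot_kill:
  assumes "C \<in> carrier (gm_quot FM (low_zero j))" "j \<le> p"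
  shows "hm p (a [^] p) \<odot>\<^bsub>gm_quot FM (low_zero j)\<^esub> C = low_zero j"
proof -
  obtain x where x: "x \<in> carrier FC" "C = (\<Union>n\<in>low_zero j. {n \<oplus>\<^bsub>FC\<^esub> x})"
    using assms by (auto simp: gm_quot_def A_RCOSETS_def' a_r_coset_def' fiber_module_simps)
  have "\<zero>\<^bsub>FC\<^esub> \<in> low_zero j"
    using mono_closed[OF pw_closed(3)[of 1]] mono_zero_iff[OF pw_closed(3)[of 1]] additive_subgroup.zero_closed[OF ideal.axioms(1)[OF den_ideal]]
    by (simp add: low_zero_def FC_simps)
  then have ne: "C \<noteq> {}" using x by blast
  have "y \<in> carrier FC" if "y \<in> C" for y
    using that x FC_add_closed by (auto simp: low_zero_def)
  then have "hm p (a [^] p) \<odot>\<^bsub>FM\<^esub> y \<in> low_zero j" if "y \<in> C" for y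
    using that assms(2) mono_mult_low_zero by (simp add: FM_smult)
  then have "low_zero j +>\<^bsub>FM\<^esub> (hm p (a [^] p) \<odot>\<^bsub>FM\<^esub> y) = low_zero j" if "y \<in> C" for y
    using that low_zero_coset by (simp add: a_r_coset_def' fiber_module_simps(2))
  then have "(\<Union>y\<in>C. low_zero j +>\<^bsub>FM\<^esub> (hm p (a [^] p) \<odot>\<^bsub>FM\<^esub> y)) = low_zero j" using ne by auto
  then show ?thesis by (simp add: gm_quot_def)
qed

end

section \<open>Shifts, direct sums and the components of a graded decomposition\<close>

lemma dsum_simps:
  "carrier (gm_dsum K M) = {f \<in> (\<Pi>\<^sub>E k\<in>K. carrier (M k)). finite {k\<in>K. f k \<noteq> \<zero>\<^bsub>M k\<^esub>}}"
  "\<zero>\<^bsub>gm_dsum K M\<^esub> = (\<lambda>k\<in>K. \<zero>\<^bsub>M k\<^esub>)"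
  "f \<oplus>\<^bsub>gm_dsum K M\<^esub> g = (\<lambda>k\<in>K. f k \<oplus>\<^bsub>M k\<^esub> g k)"
  "s \<odot>\<^bsub>gm_dsum K M\<^esub> f = (\<lambda>k\<in>K. s \<odot>\<^bsub>M k\<^esub> f k)"
  "homog (gm_dsum K M) n = {f \<in> carrier (gm_dsum K M). \<forall>k\<in>K. f k \<in> homog (M k) n}"
  by (simp_all add: gm_dsum_def Let_def)

lemma shift_simps [simp]:
  "carrier (gm_shift i M) = carrier M" "\<zero>\<^bsub>gm_shift i M\<^esub> = \<zero>\<^bsub>M\<^esub>"
  "x \<oplus>\<^bsub>gm_shift i M\<^esub> y = x \<oplus>\<^bsub>M\<^esub> y" "s \<odot>\<^bsub>gm_shift i M\<^esub> y = s \<odot>\<^bsub>M\<^esub> y"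
  "homog (gm_shift i M) n = (if n < i then {\<zero>\<^bsub>M\<^esub>} else homog M (n - i))"
  by (simp_all add: gm_shift_def)

lemma plus_simps:
  "carrier (gm_plus M N) = carrier M \<times> carrier N"
  "x \<oplus>\<^bsub>gm_plus M N\<^esub> y = (fst x \<oplus>\<^bsub>M\<^esub> fst y, snd x \<oplus>\<^bsub>N\<^esub> snd y)"
  "s \<odot>\<^bsub>gm_plus M N\<^esub> y = (s \<odot>\<^bsub>M\<^esub> fst y, s \<odot>\<^bsub>N\<^esub> snd y)"
  "homog (gm_plus M N) n = homog M n \<times> homog N n"
  by (simp_all add: gm_plus_def split_beta)

context principal_regular
begin

text \<open>The first five properties describe the projections of \<open>F(I)\<close> to its free summands; the last
  one holds because \<open>a\<^sup>r\<close> kills the remaining summands.\<close>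

lemma fiber_decomposition_components:
  assumes dec: "fiber_decomposition R \<mm> I a r \<alpha> \<tau>"
    and I: "ideal I R" and sub: "J \<subseteq> I" and M_def: "M = fiber_module R \<mm> I"
  obtains H :: "nat \<Rightarrow> nat \<Rightarrow> (nat \<Rightarrow> 'a set) \<Rightarrow> (nat \<Rightarrow> 'a set)" where
    "\<And>i l x. i \<le> r \<Longrightarrow> l < \<alpha> i \<Longrightarrow> x \<in> carrier M \<Longrightarrow> H i l x \<in> carrier FM"
    "\<And>i l x y. i \<le> r \<Longrightarrow> l < \<alpha> i \<Longrightarrow> x \<in> carrier M \<Longrightarrow> y \<in> carrier M \<Longrightarrow>
       H i l (x \<oplus>\<^bsub>M\<^esub> y) = H i l x \<oplus>\<^bsub>FM\<^esub> H i l y"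
    "\<And>i l s x. i \<le> r \<Longrightarrow> l < \<alpha> i \<Longrightarrow> s \<in> carrier FC \<Longrightarrow> x \<in> carrier M \<Longrightarrow>
       H i l (s \<odot>\<^bsub>M\<^esub> x) = s \<odot>\<^bsub>FM\<^esub> H i l x"
    "\<And>i l n x. i \<le> r \<Longrightarrow> l < \<alpha> i \<Longrightarrow> x \<in> homog M n \<Longrightarrow>
       H i l x \<in> homog (gm_shift i FM) n"
    "\<And>i l n x g. i \<le> r \<Longrightarrow> l < \<alpha> i \<Longrightarrow> i \<le> n \<Longrightarrow> x \<in> homog M n \<Longrightarrow> g \<in> homog FM (n - i) \<Longrightarrow>
       \<exists>y\<in>homog M n. \<forall>i' l'. H i' l' y = (if i' = i \<and> l' = l then g else H i' l' x)"
    "\<And>x y. x \<in> carrier M \<Longrightarrow> y \<in> carrier M \<Longrightarrow>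
       \<forall>i\<le>r. \<forall>l<\<alpha> i. H i l x = H i l y \<Longrightarrow>
       hm r (a [^] r) \<odot>\<^bsub>M\<^esub> x = hm r (a [^] r) \<odot>\<^bsub>M\<^esub> y"
proof -
  define D1 where "D1 = gm_dsum {0..r} (\<lambda>i. gm_power (gm_shift i FM) (\<alpha> i))"
  define T where "T = (\<lambda>i j. gm_power (gm_shift i (gm_quot FM (low_zero j))) (\<tau> i j))"
  define D2 where "D2 = gm_dsum {1..r - 1} (\<lambda>i. gm_dsum {1..r - i} (T i))"
  interpret I: ideal_in_cring R \<mm> I
    by (intro ideal_in_cring.intro ideal_in_cring_axioms.intro is_cring m_ideal I)
  have "a [^] r \<in> I.pw r" using ideal_pow_mono[OF sub L_ideal I] pw_principal_mem by blast
  then have closed: "hm r (a [^] r) \<odot>\<^bsub>M\<^esub> x \<in> carrier M" if "x \<in> carrier M" for x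
    using that I.mono_mult_closed I.fiber_map_mono[OF L_ideal sub pw_principal_mem(2)] unfolding M_def I.fiber_module_simps by simp
  have "gm_isomorphic FC M (gm_plus D1 D2)"
    using dec unfolding fiber_decomposition_def Let_def PIdl_class_pow D1_def D2_def T_def M_def .
  then obtain h where bij: "bij_betw h (carrier M) (carrier D1 \<times> carrier D2)"
    and add: "\<And>x y. x \<in> carrier M \<Longrightarrow> y \<in> carrier M \<Longrightarrow>
       h (x \<oplus>\<^bsub>M\<^esub> y) = (fst (h x) \<oplus>\<^bsub>D1\<^esub> fst (h y), snd (h x) \<oplus>\<^bsub>D2\<^esub> snd (h y))"
    and smult: "\<And>s x. s \<in> carrier FC \<Longrightarrow> x \<in> carrier M \<Longrightarrow>
       h (s \<odot>\<^bsub>M\<^esub> x) = (s \<odot>\<^bsub>D1\<^esub> fst (h x), s \<odot>\<^bsub>D2\<^esub> snd (h x))"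
    and hom: "\<And>n. h ` homog M n = homog D1 n \<times> homog D2 n"
    unfolding gm_isomorphic_def plus_simps by metis
  have mem: "fst (h x) \<in> carrier D1" "snd (h x) \<in> carrier D2" if "x \<in> carrier M" for x
    using bij_betwE[OF bij] that by (auto simp: mem_Times_iff)
  have hmem: "fst (h x) \<in> homog D1 n" "snd (h x) \<in> homog D2 n" if "x \<in> homog M n" for x n
    using hom[of n] that by (auto simp: mem_Times_iff dest!: equalityD1)
  have D1c: "f i l \<in> carrier FM" if "f \<in> carrier D1" "i \<le> r" "l < \<alpha> i" for f i l
  proof -
    have "f i \<in> carrier (gm_power (gm_shift i FM) (\<alpha> i))"
      using that unfolding D1_def dsum_simps by (auto simp: PiE_iff)
    then show ?thesis using that unfolding gm_power_def dsum_simps by (auto simp: PiE_iff)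
  qed
  have D1h: "f i l \<in> homog (gm_shift i FM) n" if "f \<in> homog D1 n" "i \<le> r" "l < \<alpha> i" for f i l n
  proof -
    have "f i \<in> homog (gm_power (gm_shift i FM) (\<alpha> i)) n"
      using that unfolding D1_def dsum_simps(5) by simp
    then show ?thesis using that unfolding gm_power_def dsum_simps(5) by simp
  qed
  \<comment> \<open>One component of a homogeneous family can be prescribed freely; pulled back
    along the surjection in degree \<open>n\<close>, this produces the dual basis vectors later
    on.\<close>
  have D1u: "f(i := (f i)(l := g)) \<in> homog D1 n"
    if f: "f \<in> homog D1 n" and i: "i \<le> r" "l < \<alpha> i" "i \<le> n" and g: "g \<in> homog FM (n - i)" for f i l n g
  proof -
    let ?P = "\<lambda>i. gm_power (gm_shift i FM) (\<alpha> i)"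
    have f1: "f \<in> (\<Pi>\<^sub>E k\<in>{0..r}. carrier (?P k))" "\<And>k. k \<le> r \<Longrightarrow> f k \<in> homog (?P k) n"
      using f unfolding D1_def dsum_simps by auto
    have "g \<in> carrier FM" using g by (simp add: fiber_module_simps)
    then have "(f i)(l := g) \<in> homog (?P i) n"
      using f1(2)[OF i(1)] i g unfolding gm_power_def dsum_simps by (auto simp: PiE_iff extensional_def)
    then have F: "(f i)(l := g) \<in> homog (?P i) n" "(f i)(l := g) \<in> carrier (?P i)"
      unfolding gm_power_def dsum_simps by auto
    then have "f(i := (f i)(l := g)) \<in> (\<Pi>\<^sub>E k\<in>{0..r}. carrier (?P k))"
      using f1(1) i by (auto simp: PiE_iff extensional_def)
    then show ?thesis using f1(2) F(1) unfolding D1_def dsum_simps by auto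
  qed
  have D1s: "s \<odot>\<^bsub>D1\<^esub> f = s \<odot>\<^bsub>D1\<^esub> f'" if "\<And>i l. i \<le> r \<Longrightarrow> l < \<alpha> i \<Longrightarrow> f i l = f' i l" for s f f'
    using that unfolding D1_def gm_power_def dsum_simps by (auto intro!: restrict_ext)
  \<comment> \<open>All exponents satisfy \<open>j \<le> r - i \<le> r\<close>, so
    \<open>a^r\<close> sends every component to zero and both sides agree.\<close>
  have D2s: "hm r (a [^] r) \<odot>\<^bsub>D2\<^esub> q = hm r (a [^] r) \<odot>\<^bsub>D2\<^esub> q'" if q: "q \<in> carrier D2" "q' \<in> carrier D2" for q q'
  proof -
    have kill: "hm r (a [^] r) \<odot>\<^bsub>gm_quot FM (low_zero j)\<^esub> q i j l = low_zero j"
      if "q \<in> carrier D2" "i \<in> {1..r - 1}" "j \<in> {1..r - i}" "l < \<tau> i j" for q i j l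
    proof (rule quot_kill)
      have "q i \<in> carrier (gm_dsum {1..r - i} (T i))"
        using that unfolding D2_def dsum_simps(1)[of "{1..r - 1}"] by (auto simp: PiE_iff)
      then have "q i j \<in> carrier (T i j)"
        using that unfolding dsum_simps(1)[of "{1..r - i}"] by (auto simp: PiE_iff)
      then show "q i j l \<in> carrier (gm_quot FM (low_zero j))"
        using that unfolding T_def gm_power_def dsum_simps by (auto simp: PiE_iff)
    qed (use that in auto)
    show ?thesis unfolding D2_def dsum_simps(4) T_def gm_power_def shift_simps(4)
      by (intro restrict_ext) (simp add: kill[OF q(1)] kill[OF q(2)] del: One_nat_def)
  qed
  \<comment> \<open>\<open>H i l\<close> is the isomorphism followed by the projection to copy
    \<open>l\<close> of \<open>F(J)(-i)\<close>. Outside the index range its values carry no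
    information.\<close>
  show ?thesis
  proof (rule that[of "\<lambda>i l x. fst (h x) i l"], goal_cases)
    case (1 i l x) then show ?case using D1c mem by blast
  next
    case (2 i l x y) then show ?case by (simp add: add D1_def gm_power_def dsum_simps)
  next
    case (3 i l s x) then show ?case by (simp add: smult D1_def gm_power_def dsum_simps)
  next
    case (4 i l n x) then show ?case using D1h hmem by blast
  next
    case (5 i l n x g)
    then have "((fst (h x))(i := (fst (h x) i)(l := g)), snd (h x)) \<in> h ` homog M n"
      unfolding hom using D1u hmem by blast
    then obtain y where y: "y \<in> homog M n" "h y = ((fst (h x))(i := (fst (h x) i)(l := g)), snd (h x))" by auto
    then show ?case by (intro bexI[of _ y]) auto
  next
    case (6 x y)
    have s: "hm r (a [^] r) \<in> carrier FC" by (simp add: mono_closed)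
    have e: "fst (h x) i l = fst (h y) i l" if "i \<le> r" "l < \<alpha> i" for i l
      using 6(3) that by blast
    \<comment> \<open>The free parts agree by assumption and the other parts are killed by
      \<open>a^r\<close>; injectivity of \<open>h\<close> then transfers the equality to
      \<open>F(I)\<close>. Comparing two elements avoids subtraction in \<open>F(I)\<close>.\<close>
    have "h (hm r (a [^] r) \<odot>\<^bsub>M\<^esub> x) = h (hm r (a [^] r) \<odot>\<^bsub>M\<^esub> y)"
      unfolding smult[OF s 6(1)] smult[OF s 6(2)]
      using D1s[OF e] D2s[OF mem(2)[OF 6(1)] mem(2)[OF 6(2)]] by (rule arg_cong2)
    then show ?case using bij closed 6 unfolding bij_betw_def inj_on_def by blast
  qed
qed
end

section \<open>Torsion of the fiber cone\<close>

text \<open>A subset of \<open>I^n\<close> rather than of \<open>I^n/\<mm>I^n\<close>: it is the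
  full preimage of the torsion, and contains \<open>\<mm>I^n\<close> by the choice
  \<open>k = 0\<close>. In this form it can be the common \<open>W\<close> of two dual
  systems.\<close>

definition (in cring) fiber_torsion :: "'a set \<Rightarrow> 'a set \<Rightarrow> 'a \<Rightarrow> nat \<Rightarrow> 'a set" where
  "fiber_torsion \<mm> L a n = {x \<in> ideal_pow R L n. \<exists>k::nat. a [^] k \<otimes> x \<in> fiber_den R \<mm> L (k + n)}"

text \<open>The index set has one element for each free summand \<open>F(J)(-i)\<close> that is
  non-zero in degree \<open>n\<close>. The functional is the coefficient of \<open>a^(n - i)\<close>
  in that summand, and the dual vector is a preimage of \<open>a^(n - i)\<close>.\<close>

lemma (in principal_regular) fiber_decomposition_dual_system:
  assumes dec: "fiber_decomposition R \<mm> I a r \<alpha> \<tau>" and I: "ideal I R" and sub: "J \<subseteq> I"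
  shows "\<exists>\<phi> e. dual_system R \<mm> (ideal_pow R I n) (fiber_torsion \<mm> I a n)
    (SIGMA i:{..min n r}. {..<\<alpha> i}) \<phi> e"
proof -
  interpret I: ideal_in_cring R \<mm> I
    by (intro ideal_in_cring.intro ideal_in_cring_axioms.intro is_cring m_ideal I)
  define M where "M = fiber_module R \<mm> I"
  have carrM: "carrier M = carrier I.FC" by (simp add: M_def I.fiber_module_simps)
  obtain H where
    H1: "\<And>i l x. i \<le> r \<Longrightarrow> l < \<alpha> i \<Longrightarrow> x \<in> carrier M \<Longrightarrow> H i l x \<in> carrier FM" and
    H2: "\<And>i l x y. i \<le> r \<Longrightarrow> l < \<alpha> i \<Longrightarrow> x \<in> carrier M \<Longrightarrow> y \<in> carrier M \<Longrightarrow>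
       H i l (x \<oplus>\<^bsub>M\<^esub> y) = H i l x \<oplus>\<^bsub>FM\<^esub> H i l y" and
    H3: "\<And>i l s x. i \<le> r \<Longrightarrow> l < \<alpha> i \<Longrightarrow> s \<in> carrier FC \<Longrightarrow> x \<in> carrier M \<Longrightarrow>
       H i l (s \<odot>\<^bsub>M\<^esub> x) = s \<odot>\<^bsub>FM\<^esub> H i l x" and
    H4: "\<And>i l n x. i \<le> r \<Longrightarrow> l < \<alpha> i \<Longrightarrow> x \<in> homog M n \<Longrightarrow>
       H i l x \<in> homog (gm_shift i FM) n" and
    H5: "\<And>i l n x g. i \<le> r \<Longrightarrow> l < \<alpha> i \<Longrightarrow> i \<le> n \<Longrightarrow> x \<in> homog M n \<Longrightarrow> g \<in> homog FM (n - i) \<Longrightarrow>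
       \<exists>y\<in>homog M n. \<forall>i' l'. H i' l' y = (if i' = i \<and> l' = l then g else H i' l' x)" and
    H6: "\<And>x y. x \<in> carrier M \<Longrightarrow> y \<in> carrier M \<Longrightarrow>
       \<forall>i\<le>r. \<forall>l<\<alpha> i. H i l x = H i l y \<Longrightarrow>
       hm r (a [^] r) \<odot>\<^bsub>M\<^esub> x = hm r (a [^] r) \<odot>\<^bsub>M\<^esub> y"
    by (rule fiber_decomposition_components[OF dec I sub M_def]) (rule that)
  have hmM: "I.hm n x \<in> carrier M" if "x \<in> I.pw n" for x n
    using that by (simp add: carrM I.mono_closed)
  have act: "hm p u \<odot>\<^bsub>M\<^esub> I.hm n x = I.hm (p + n) (u \<otimes> x)" if "u \<in> pw p" "x \<in> I.pw n" for p u n x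
  proof -
    have "u \<in> I.pw p" using that ideal_pow_mono[OF sub L_ideal I] by blast
    then show ?thesis
      using that I.fiber_map_mono[OF L_ideal sub that(1)] unfolding M_def I.fiber_module_simps
      by (simp add: I.mono_mult_mono)
  qed
  \<comment> \<open>Elements of the ring act through degree 0 of \<open>F(J)\<close>, which makes
    the coordinates linear over the ring.\<close>
  have one0: "c \<in> pw 0" if "c \<in> carrier R" for c using pw_principal_mem(1)[OF that, of 0] that by simp
  let ?K = "SIGMA i:{..min n r}. {..<\<alpha> i}"
  \<comment> \<open>Degree \<open>n\<close> of the shifted module \<open>F(J)(-i)\<close> is degree
    \<open>n - i\<close> of \<open>F(J)\<close>.\<close>
  define \<phi> where "\<phi> = (\<lambda>(i, l) x. coord (n - i) (H i l (I.hm n x) (n - i)))"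
  have rep: "\<exists>c\<in>carrier R. H i l (I.hm n x) (n - i) = den (n - i) +> c \<otimes> a [^] (n - i) \<and> \<phi> (i, l) x = \<mm> +> c"
    if "(i, l) \<in> ?K" "x \<in> I.pw n" for i l x
    using that H1[of i l "I.hm n x"] FC_principal[of "H i l (I.hm n x)" "n - i"] hmM coord_coset
    by (auto simp: \<phi>_def fiber_module_simps)
  interpret Q: ideal \<mm> R by (rule m_ideal)
  have Qz: "\<mm> +> c = \<mm> \<longleftrightarrow> c \<in> \<mm>" if "c \<in> carrier R" for c
    using that a_rcos_zero[OF m_ideal] Q.rcos_const_imp_mem by blast
  have H0: "H i l (I.hm p \<zero>) = \<zero>\<^bsub>FC\<^esub>" if "i \<le> r" "l < \<alpha> i" for i l p
  proof (rule FC_add_idem)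
    have z: "\<zero> \<in> I.pw p" by (rule I.pw_closed)
    show "H i l (I.hm p \<zero>) \<in> carrier FC" using H1[OF that hmM[OF z]] by (simp add: fiber_module_simps)
    have "I.hm p \<zero> \<oplus>\<^bsub>M\<^esub> I.hm p \<zero> = I.hm p \<zero>"
      using I.mono_add[OF z z] by (simp add: M_def I.fiber_module_simps)
    then show "H i l (I.hm p \<zero>) \<oplus>\<^bsub>FC\<^esub> H i l (I.hm p \<zero>) = H i l (I.hm p \<zero>)"
      using H2[OF that hmM[OF z] hmM[OF z]] by (simp add: fiber_module_simps)
  qed
  \<comment> \<open>The remaining components are required to be those of the zero element, not
    \<open>0\<close>, since \<open>H\<close> has no prescribed value at indices outside the
    range.\<close>
  let ?E = "\<lambda>k x. x \<in> I.pw n \<and> (\<forall>i l. H i l (I.hm n x) =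
     (if i = fst k \<and> l = snd k then hm (n - fst k) (a [^] (n - fst k)) else H i l (I.hm n \<zero>)))"
  have "\<exists>x. ?E k x" if "k \<in> ?K" for k
  proof -
    have k: "fst k \<le> r" "snd k < \<alpha> (fst k)" "fst k \<le> n" using that by auto
    have "I.hm n \<zero> \<in> homog M n" using I.mono_homog[OF I.pw_closed(3)] unfolding M_def .
    moreover have "hm (n - fst k) (a [^] (n - fst k)) \<in> homog FM (n - fst k)"
      by (rule mono_homog[OF pw_principal_mem(2)])
    ultimately obtain y where y: "y \<in> homog M n"
      "\<forall>i l. H i l y = (if i = fst k \<and> l = snd k then hm (n - fst k) (a [^] (n - fst k)) else H i l (I.hm n \<zero>))"
      by (rule bexE[OF H5[OF k]])
    obtain x where "x \<in> I.pw n" "y = I.hm n x" using I.homog_mono y(1) unfolding M_def by blast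
    then show ?thesis using y(2) by blast
  qed
  then obtain e where "\<forall>k\<in>?K. ?E k (e k)" using bchoice[of ?K ?E] by blast
  then have e: "\<And>k. k \<in> ?K \<Longrightarrow> e k \<in> I.pw n"
    "\<And>k i l. k \<in> ?K \<Longrightarrow> H i l (I.hm n (e k)) =
     (if i = fst k \<and> l = snd k then hm (n - fst k) (a [^] (n - fst k)) else H i l (I.hm n \<zero>))"
    by blast+
  have A1: "\<phi> (i, l) x \<in> carrier (R Quot \<mm>)" if "(i, l) \<in> ?K" "x \<in> I.pw n" for i l x
    using rep[OF that] by (auto simp: FactRing_def A_RCOSETS_def')
  have A2: "\<phi> (i, l) (x \<oplus> y) = \<phi> (i, l) x \<oplus>\<^bsub>R Quot \<mm>\<^esub> \<phi> (i, l) y"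
    if il: "(i, l) \<in> ?K" and x: "x \<in> I.pw n" and y: "y \<in> I.pw n" for i l x y
  proof -
    obtain c where c: "c \<in> carrier R" "H i l (I.hm n x) (n - i) = den (n - i) +> c \<otimes> a [^] (n - i)" "\<phi> (i, l) x = \<mm> +> c"
      using rep[OF il x] by blast
    obtain d where d: "d \<in> carrier R" "H i l (I.hm n y) (n - i) = den (n - i) +> d \<otimes> a [^] (n - i)" "\<phi> (i, l) y = \<mm> +> d"
      using rep[OF il y] by blast
    have "I.hm n (x \<oplus> y) = I.hm n x \<oplus>\<^bsub>M\<^esub> I.hm n y"
      using I.mono_add[OF x y] by (simp add: M_def I.fiber_module_simps)
    then have "H i l (I.hm n (x \<oplus> y)) = H i l (I.hm n x) \<oplus>\<^bsub>FC\<^esub> H i l (I.hm n y)"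
      using H2[of i l "I.hm n x" "I.hm n y"] il hmM x y by (simp add: fiber_module_simps)
    then have "H i l (I.hm n (x \<oplus> y)) (n - i) = den (n - i) +> (c \<oplus> d) \<otimes> a [^] (n - i)"
      using c d by (simp add: FC_simps coset_add l_distr)
    then show ?thesis using c d coord_coset[of "c \<oplus> d" "n - i"] Q.a_rcos_sum[of c d]
      by (simp add: \<phi>_def FactRing_def)
  qed
  have A3: "\<phi> (i, l) (c \<otimes> x) = (\<mm> +> c) \<otimes>\<^bsub>R Quot \<mm>\<^esub> \<phi> (i, l) x"
    if il: "(i, l) \<in> ?K" and c: "c \<in> carrier R" and x: "x \<in> I.pw n" for i l c x
  proof -
    obtain d where d: "d \<in> carrier R" "H i l (I.hm n x) (n - i) = den (n - i) +> d \<otimes> a [^] (n - i)" "\<phi> (i, l) x = \<mm> +> d"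
      using rep[OF il x] by blast
    have "H i l (I.hm n (c \<otimes> x)) = hm 0 c \<otimes>\<^bsub>FC\<^esub> H i l (I.hm n x)"
      using act[OF one0[OF c] x] H3[of i l "hm 0 c" "I.hm n x"] il mono_closed[OF one0[OF c]] hmM[OF x]
        FM_smult[OF one0[OF c]] by simp
    then have "H i l (I.hm n (c \<otimes> x)) (n - i) = rcoset_mult R (den (n - i)) (den 0 +> c) (den (n - i) +> d \<otimes> a [^] (n - i))"
      using mono_mult[OF one0[OF c], of "H i l (I.hm n x)" "n - i"] H1[of i l "I.hm n x"] il hmM[OF x] d
      by (simp add: fiber_module_simps)
    also have "\<dots> = den (n - i) +> (c \<otimes> d) \<otimes> a [^] (n - i)"
      using coset_mult[OF one0[OF c] pw_principal_mem(1)[OF d(1)], of "n - i"] c d by (simp add: m_assoc)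
    finally show ?thesis using c d coord_coset[of "c \<otimes> d" "n - i"] Q.rcoset_mult_add[of c d]
      by (simp add: \<phi>_def FactRing_def)
  qed
  have A4: "x \<in> fiber_torsion \<mm> I a n \<longleftrightarrow> (\<forall>k\<in>?K. \<phi> k x = \<zero>\<^bsub>R Quot \<mm>\<^esub>)" if x: "x \<in> I.pw n" for x
  proof
    assume "x \<in> fiber_torsion \<mm> I a n"
    then obtain k where k: "a [^] (k::nat) \<otimes> x \<in> I.den (k + n)" by (auto simp: fiber_torsion_def)
    have "\<phi> (i, l) x = \<zero>\<^bsub>R Quot \<mm>\<^esub>" if "(i, l) \<in> ?K" for i l
    proof -
      have il: "(i, l) \<in> ?K" "i \<le> r" "l < \<alpha> i" using that by auto
      obtain d where d: "d \<in> carrier R" "H i l (I.hm n x) (n - i) = den (n - i) +> d \<otimes> a [^] (n - i)" "\<phi> (i, l) x = \<mm> +> d"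
        using rep[OF il(1) x] by blast
      have "I.hm (k + n) (a [^] k \<otimes> x) = I.hm (k + n) \<zero>"
        using I.mono_zero_iff[OF subsetD[OF I.den_subset k]] k I.mono_zero_iff[OF I.pw_closed(3)]
          additive_subgroup.zero_closed[OF ideal.axioms(1)[OF I.den_ideal]] by simp
      then have "H i l (hm k (a [^] k) \<odot>\<^bsub>M\<^esub> I.hm n x) = \<zero>\<^bsub>FC\<^esub>"
        using act[OF _ x, of "a [^] k" k] H0[OF il(2,3)] by simp
      then have "hm k (a [^] k) \<otimes>\<^bsub>FC\<^esub> H i l (I.hm n x) = \<zero>\<^bsub>FC\<^esub>"
        using H3[OF il(2,3), of "hm k (a [^] k)" "I.hm n x"] mono_closed[of "a [^] k" k] hmM[OF x] FM_smult[of "a [^] k" k] by simp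
      \<comment> \<open>In this degree the product is the class of \<open>d a^(k + n - i)\<close>;
        its vanishing forces \<open>d \<in> \<mm>\<close> because \<open>a\<close> can be
        cancelled.\<close>
      then have "(hm k (a [^] k) \<otimes>\<^bsub>FC\<^esub> H i l (I.hm n x)) (k + (n - i)) = den (k + (n - i))"
        by (simp add: FC_simps)
      then have "den (k + (n - i)) +> a [^] k \<otimes> (d \<otimes> a [^] (n - i)) = den (k + (n - i))"
        using mono_mult[of "a [^] k" k "H i l (I.hm n x)" "k + (n - i)"] H1[OF il(2,3) hmM[OF x]] d
          coset_mult[of "a [^] k" k "d \<otimes> a [^] (n - i)" "n - i"] by (simp add: fiber_module_simps)
      moreover have "a [^] k \<otimes> (d \<otimes> a [^] (n - i)) = d \<otimes> a [^] (k + (n - i))"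
        using d a_carr by (simp add: nat_pow_mult[symmetric] m_ac)
      ultimately have "d \<in> \<mm>" using d den_principal_iff by (simp add: coset_zero_iff)
      then show ?thesis using d Qz by (simp add: FactRing_def)
    qed
    then show "\<forall>k\<in>?K. \<phi> k x = \<zero>\<^bsub>R Quot \<mm>\<^esub>" by (metis prod.collapse)
  next
    assume z: "\<forall>k\<in>?K. \<phi> k x = \<zero>\<^bsub>R Quot \<mm>\<^esub>"
    have zp: "\<zero> \<in> I.pw n" by (rule I.pw_closed(3))
    have "H i l (I.hm n x) = H i l (I.hm n \<zero>)" if il: "i \<le> r" "l < \<alpha> i" for i l
    proof -
      have h: "H i l (I.hm n x) \<in> homog (gm_shift i FM) n"
        using H4[OF il] I.mono_homog[OF x] unfolding M_def by blast
      have "H i l (I.hm n x) = \<zero>\<^bsub>FC\<^esub>"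
      \<comment> \<open>Summands with \<open>n < i\<close> have no index in \<open>?K\<close>, so
        \<open>\<phi>\<close> says nothing about them; there the shifted module is zero in degree
        \<open>n\<close>.\<close>
      proof (cases "n < i")
        case True
        then show ?thesis using h by (simp add: fiber_module_simps)
      next
        case False
        then have K: "(i, l) \<in> ?K" using il by auto
        obtain d where d: "d \<in> carrier R" "H i l (I.hm n x) (n - i) = den (n - i) +> d \<otimes> a [^] (n - i)" "\<phi> (i, l) x = \<mm> +> d"
          using rep[OF K x] by blast
        have "\<phi> (i, l) x = \<mm>" using z K by (auto simp: FactRing_def)
        then have "d \<in> \<mm>" using d Qz by simp
        then have "H i l (I.hm n x) (n - i) = den (n - i)"
          using d den_principal_iff[of d "n - i"] by (simp add: coset_zero_iff)
        moreover have "H i l (I.hm n x) k = den k" if "k \<noteq> n - i" for k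
          using h False that by (simp add: fiber_module_simps)
        ultimately have "H i l (I.hm n x) k = den k" for k by (cases "k = n - i") auto
        then show ?thesis by (simp add: FC_simps fun_eq_iff)
      qed
      then show ?thesis using H0[OF il] by simp
    qed
    \<comment> \<open>Comparison with the zero element shows that \<open>a^r\<close> kills the class
      of \<open>x\<close>, so \<open>k = r\<close> witnesses torsion.\<close>
    then have "hm r (a [^] r) \<odot>\<^bsub>M\<^esub> I.hm n x = hm r (a [^] r) \<odot>\<^bsub>M\<^esub> I.hm n \<zero>"
      using H6[OF hmM[OF x] hmM[OF zp]] by blast
    then have "I.hm (r + n) (a [^] r \<otimes> x) = I.hm (r + n) \<zero>"
      using act[OF _ x, of "a [^] r" r] act[OF _ zp, of "a [^] r" r] by simp
    then have "I.den (r + n) +> a [^] r \<otimes> x = I.den (r + n)"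
      unfolding fiber_mono_def fun_eq_iff by (auto dest: spec[of _ "r + n"])
    then have "a [^] r \<otimes> x \<in> I.den (r + n)"
      using I.coset_zero_iff[of "a [^] r \<otimes> x"] I.pw_carr[OF x] by simp
    then show "x \<in> fiber_torsion \<mm> I a n" using x unfolding fiber_torsion_def by blast
  qed
  have A5: "\<phi> k' (e k) = (if k' = k then \<one>\<^bsub>R Quot \<mm>\<^esub> else \<zero>\<^bsub>R Quot \<mm>\<^esub>)" if k: "k \<in> ?K" "k' \<in> ?K" for k k'
  proof -
    obtain i l where il: "k' = (i, l)" "i \<le> r" "l < \<alpha> i" using k by auto
    have v: "\<phi> k' (e k) = coord (n - i) (H i l (I.hm n (e k)) (n - i))" unfolding \<phi>_def il(1) by simp
    show ?thesis
    proof (cases "k' = k")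
      case True
      then have "fst k = i" "snd k = l" using il(1) by auto
      then have "H i l (I.hm n (e k)) = hm (n - i) (a [^] (n - i))"
        using e(2)[OF k(1), of i l] by simp
      then have "H i l (I.hm n (e k)) (n - i) = den (n - i) +> \<one> \<otimes> a [^] (n - i)"
        unfolding fiber_mono_def by simp
      then show ?thesis unfolding v using coord_coset[OF one_closed, of "n - i"] True by (simp add: FactRing_def)
    next
      case False
      then have ne: "\<not> (i = fst k \<and> l = snd k)" using il(1) by auto
      have "H i l (I.hm n (e k)) = \<zero>\<^bsub>FC\<^esub>"
        unfolding e(2)[OF k(1)] if_not_P[OF ne] by (rule H0[OF il(2,3)])
      then have "H i l (I.hm n (e k)) (n - i) = den (n - i) +> \<zero> \<otimes> a [^] (n - i)"
        by (simp add: FC_simps)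
      then show ?thesis unfolding v using coord_coset[OF zero_closed, of "n - i"] False Qz[OF zero_closed]
        by (simp add: FactRing_def)
    qed
  qed
  have "dual_system R \<mm> (I.pw n) (fiber_torsion \<mm> I a n) ?K \<phi> e"
    unfolding dual_system_def
  proof (intro conjI ballI, goal_cases)
    case (1 k x) then show ?case using A1[of "fst k" "snd k"] by simp
  next
    case (2 k x y) then show ?case using A2[of "fst k" "snd k"] by simp
  next
    case (3 k c x) then show ?case using A3[of "fst k" "snd k"] by simp
  next
    case (4 x) then show ?case by (rule A4)
  next
    case (5 k) then show ?case by (rule e(1))
  next
    case (6 k l) then show ?case by (rule A5)
  qed
  then show ?thesis by blast
qed

section \<open>Consequences of the reduction equation for a principal reduction\<close>

text \<open>Multiplying \<open>I^(s+1) = a I^s\<close> by \<open>I^k\<close> yields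
  \<open>I^(s+k+1) = a I^(s+k)\<close>, and this is iterated. The use lies in divisibility: every
  element of \<open>I^(s+k)\<close> is \<open>a^k\<close> times an element of
  \<open>I^s\<close>.\<close>

lemma (in cring) reduction_pow:
  assumes I: "ideal I R" and a: "a \<in> carrier R"
    and red: "ideal_pow R I (Suc s) = ideal_prod R (PIdl a) (ideal_pow R I s)"
  shows "ideal_pow R I (s + k) = (\<lambda>z. z \<otimes> a [^] k) ` ideal_pow R I s"
proof (induction k)
  case 0
  then show ?case using ideal.Icarr[OF ideal_pow_ideal[OF I]] by (auto simp: image_iff)
next
  case (Suc k)
  have idl: "ideal (ideal_pow R I n) R" for n by (rule ideal_pow_ideal[OF I])
  have carr: "z \<in> carrier R" if "z \<in> ideal_pow R I s" for z using ideal.Icarr[OF idl that] .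
  have "ideal_pow R I (s + Suc k) = ideal_pow R I (Suc s) \<cdot> ideal_pow R I k"
    using ideal_pow_add[OF I, of "Suc s" k] by (simp only: add_Suc add_Suc_right)
  also have "\<dots> = (PIdl a) \<cdot> (ideal_pow R I s \<cdot> ideal_pow R I k)"
    unfolding red by (rule ideal_prod_assoc[OF cgenideal_ideal[OF a] idl idl])
  also have "\<dots> = ideal_pow R I (s + k) \<cdot> (PIdl a)"
    unfolding ideal_pow_add[OF I, symmetric] by (rule ideal_prod_commute[OF cgenideal_ideal[OF a] idl])
  also have "\<dots> = (\<lambda>z. z \<otimes> a) ` (\<lambda>z. z \<otimes> a [^] k) ` ideal_pow R I s"
    unfolding ideal_prod_cgenideal[OF idl a] by (simp only: Suc)
  also have "\<dots> = (\<lambda>z. z \<otimes> a [^] Suc k) ` ideal_pow R I s"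
    using a carr by (auto simp: image_image m_assoc intro!: image_cong)
  finally show ?case .
qed

text \<open>The torsion is annihilated by a power of \<open>F(I)\<^sub>+\<close>, because \<open>I\<^sup>s\<^sup>+\<^sup>k = a\<^sup>k I\<^sup>s\<close>.\<close>

lemma (in cring) fiber_torsion_subset:
  assumes m: "ideal \<mm> R" and I: "ideal I R" and a: "a \<in> carrier R" and b: "b \<in> I"
    and red: "ideal_pow R I (Suc s) = ideal_prod R (PIdl a) (ideal_pow R I s)"
  shows "fiber_torsion \<mm> I a n \<subseteq> fiber_torsion \<mm> I b n"
proof
  fix x assume "x \<in> fiber_torsion \<mm> I a n"
  then obtain k where x: "x \<in> ideal_pow R I n" and k: "a [^] (k::nat) \<otimes> x \<in> fiber_den R \<mm> I (k + n)"
    by (auto simp: fiber_torsion_def)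
  interpret I: ideal_in_cring R \<mm> I
    by (intro ideal_in_cring.intro ideal_in_cring_axioms.intro is_cring m I)
  \<comment> \<open>The power \<open>b^(s+k)\<close> lies in \<open>I^(s+k)\<close>, hence is
    divisible by \<open>a^k\<close>; the cofactor \<open>z \<in> I^s\<close> raises the degree of
    the denominator by \<open>s\<close>, which is exactly what is required.\<close>
  obtain z where z: "z \<in> I.pw s" "b [^] (s + k) = z \<otimes> a [^] k"
    using I.pow_pw[OF b, of "s + k"] reduction_pow[OF I a red, of k] by auto
  have "b [^] (s + k) \<otimes> x = z \<otimes> (a [^] k \<otimes> x)"
    unfolding z(2) using I.pw_carr x z a by (simp add: m_assoc)
  also have "\<dots> \<in> I.den (s + k + n)" using I.den_mult_r[OF z(1) k] by (simp add: add.assoc)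
  finally show "x \<in> fiber_torsion \<mm> I b n" using x unfolding fiber_torsion_def by blast
qed

text \<open>If \<open>x \<in> I\<close> is a non-zero-divisor, so is \<open>x^(s+1)\<close>, and
  this power is a multiple of \<open>a\<close> since \<open>I^(s+1) = a I^s\<close>. Whatever
  \<open>a\<close> annihilates is therefore zero.\<close>

lemma (in cring) reduction_regular:
  assumes reg: "regular_ideal R I" and a: "a \<in> carrier R"
    and red: "ideal_pow R I (Suc s) = ideal_prod R (PIdl a) (ideal_pow R I s)"
    and y: "y \<in> carrier R" "a \<otimes> y = \<zero>"
  shows "y = \<zero>"
proof -
  have I: "ideal I R" using reg by (simp add: regular_ideal_def)
  \<comment> \<open>Only facts about powers of \<open>I\<close> are wanted here, so \<open>I\<close>
    itself takes the place of \<open>\<mm>\<close>.\<close>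
  interpret I: ideal_in_cring R I I
    by (intro ideal_in_cring.intro ideal_in_cring_axioms.intro is_cring I)
  obtain x where x: "x \<in> I" "\<And>w. w \<in> carrier R \<Longrightarrow> x \<otimes> w = \<zero> \<Longrightarrow> w = \<zero>"
    using reg by (auto simp: regular_ideal_def)
  have xc: "x \<in> carrier R" using ideal.Icarr[OF I x(1)] .
  have xp: "x [^] (n::nat) \<otimes> w = \<zero> \<Longrightarrow> w = \<zero>" if "w \<in> carrier R" for n w
    using that
  proof (induction n)
    case (Suc n)
    then have "x \<otimes> (x [^] n \<otimes> w) = \<zero>" using xc by (simp add: m_ac)
    then show ?case using x(2)[of "x [^] n \<otimes> w"] Suc xc by simp
  qed simp
  obtain z where z: "z \<in> I.pw s" "x [^] (s + 1) = z \<otimes> a [^] (1::nat)"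
    using I.pow_pw[OF x(1), of "s + 1"] reduction_pow[OF I a red, of 1] by auto
  have "x [^] (s + 1) \<otimes> y = z \<otimes> (a \<otimes> y)"
    unfolding z(2) using I.pw_carr[OF z(1)] a y(1) by (simp add: m_assoc)
  also have "\<dots> = \<zero>" using y(2) I.pw_carr[OF z(1)] by simp
  finally show ?thesis by (rule xp[OF y(1)])
qed

section \<open>Comparison of two minimal reductions\<close>

lemma partial_sums_eq_imp_eq:
  fixes \<alpha> \<beta> :: "nat \<Rightarrow> nat"
  assumes "\<And>n. n \<le> r \<Longrightarrow> (\<Sum>i\<le>n. \<alpha> i) = (\<Sum>i\<le>n. \<beta> i)" and "i \<le> r"
  shows "\<alpha> i = \<beta> i"
proof (cases i)
  case 0 then show ?thesis using assms(1)[of 0] by simp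
next
  case (Suc k) then show ?thesis using assms(1)[of k] assms(1)[of "Suc k"] assms(2) by simp
qed

theorem corollary2p8:
  fixes A :: "('a, 'b) ring_scheme" and \<mm> I :: "'a set" and a b :: 'a and r :: nat
    and \<alpha> \<beta> :: "nat \<Rightarrow> nat" and \<tau> \<sigma> :: "nat \<Rightarrow> nat \<Rightarrow> nat"
  assumes "noetherian_local_ring A \<mm>"
    and "infinite (carrier (A Quot \<mm>))"
    and "regular_ideal A I"
    and "analytic_spread A \<mm> I = 1"
    and "r = reduction_number A I"
    and "a \<in> carrier A" and "minimal_reduction A I (PIdl\<^bsub>A\<^esub> a)"
    and "fiber_decomposition A \<mm> I a r \<alpha> \<tau>"
    and "b \<in> carrier A" and "minimal_reduction A I (PIdl\<^bsub>A\<^esub> b)"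
    and "fiber_decomposition A \<mm> I b r \<beta> \<sigma>"
  shows "\<forall>i\<in>{0..r}. \<alpha> i = \<beta> i"
proof -
  interpret noetherian_local_ring A \<mm> by fact
  have P: "primeideal \<mm> A" by (rule maximalideal_prime[OF max_ideal])
  have m: "ideal \<mm> A" by (rule primeideal.axioms(1)[OF P])
  have I: "ideal I A" using assms(3) by (simp add: regular_ideal_def)
  \<comment> \<open>Any exponent supplied by the definition of a reduction will do; it is not tied
    to \<open>r\<close>.\<close>
  obtain s where s: "ideal_pow A I (Suc s) = ideal_prod A (PIdl\<^bsub>A\<^esub> a) (ideal_pow A I s)"
    and aI: "PIdl\<^bsub>A\<^esub> a \<subseteq> I"
    using assms(7) unfolding minimal_reduction_def is_reduction_def by blast
  obtain t where t: "ideal_pow A I (Suc t) = ideal_prod A (PIdl\<^bsub>A\<^esub> b) (ideal_pow A I t)"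
    and bI: "PIdl\<^bsub>A\<^esub> b \<subseteq> I"
    using assms(10) unfolding minimal_reduction_def is_reduction_def by blast
  have ab: "a \<in> I" "b \<in> I" using cgenideal_self assms(6,9) aI bI by blast+
  have pa: "principal_regular A \<mm> a"
    unfolding principal_regular_def principal_regular_axioms_def
    using is_cring P assms(6) reduction_regular[OF assms(3,6) s] by blast
  have pb: "principal_regular A \<mm> b"
    unfolding principal_regular_def principal_regular_axioms_def
    using is_cring P assms(9) reduction_regular[OF assms(3,9) t] by blast
  have sums: "(\<Sum>i\<le>n. \<alpha> i) = (\<Sum>i\<le>n. \<beta> i)" if n: "n \<le> r" for n
  proof -
    let ?K = "\<lambda>\<alpha>. SIGMA i:{..min n r}. {..<\<alpha> i :: nat}"
    \<comment> \<open>Each inclusion combines the reduction equation of one generator with the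
      membership in \<open>I\<close> of the other.\<close>
    have T: "fiber_torsion \<mm> I a n = fiber_torsion \<mm> I b n"
      using fiber_torsion_subset[OF m I assms(6) ab(2) s] fiber_torsion_subset[OF m I assms(9) ab(1) t] by blast
    obtain \<phi> e where 1: "dual_system A \<mm> (ideal_pow A I n) (fiber_torsion \<mm> I a n) (?K \<alpha>) \<phi> e"
      using principal_regular.fiber_decomposition_dual_system[OF pa assms(8) I aI] by blast
    obtain \<psi> f where 2: "dual_system A \<mm> (ideal_pow A I n) (fiber_torsion \<mm> I a n) (?K \<beta>) \<psi> f"
      using principal_regular.fiber_decomposition_dual_system[OF pb assms(11) I bI] unfolding T by blast
    \<comment> \<open>Thanks to \<open>T\<close> both systems have the same \<open>V\<close> and
      \<open>W\<close>, so the cardinality bound applies in both directions.\<close>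
    have "card (?K \<alpha>) = card (?K \<beta>)"
      using dual_system_card_le[OF P ideal_pow_ideal[OF I] _ _ 1 2]
        dual_system_card_le[OF P ideal_pow_ideal[OF I] _ _ 2 1] by simp
    \<comment> \<open>As \<open>n \<le> r\<close>, the cut-off \<open>min n r\<close> is
      \<open>n\<close>, and the cardinalities are the partial sums.\<close>
    then show ?thesis using n by (simp add: min_absorb1)
  qed
  show ?thesis
  proof
    fix i assume "i \<in> {0..r}"
    then show "\<alpha> i = \<beta> i" using partial_sums_eq_imp_eq[OF sums] by simp
  qed
qed

end
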